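(* (1) Let $L$ be a finite $(3,3)$-homogeneous orthomodular poset with exactly $15$ atoms. Then $L$ is isomorphic (as an orthomodular poset) to $\mathcal{L}^{3}_{2}=\{X\subset\{1,\dots,6\}\mid \operatorname{card}X\equiv 0 \pmod 2\}$. (2) There exist finite $(3,3)$-homogeneous orthomodular posets $L_{17}$ and $L_{27}$, having exactly $17$ and exactly $27$ atoms respectively, such that: (a) the set $S_2(L_{17})$ of two-valued states on $L_{17}$ is empty, and the convex set $S(L_{17})$ of all states on $L_{17}$ is (affinely) isomorphic to the segment $[0,\tfrac23]\subset\mathbb{R}$; (b) the set $S_2(L_{27})$ of two-valued states on $L_{27}$ is full, and the total representation of $L_{27}$ is a regular concrete logic.
   Context: An orthomodular poset (OMP) is a poset $L$ with least element $0$ and greatest element $1$ and an order-reversing involution $x\mapsto x^{\perp}$ such that $x\wedge x^{\perp}=0$ and $x\vee x^{\perp}=1$, such that $x\vee y$ exists whenever $x\perp y$ (i.e. $x\le y^{\perp}$), and such that $x\le y$ implies $y=x\vee(y\wedge x^{\perp})$. Isomorphisms of OMPs are order isomorphisms preserving the orthocomplementation. For a finite OMP $L$, a block is a maximal (with respect to inclusion) set of pairwise orthogonal atoms. $L$ is $(n,m)$-homogeneous if every atom of $L$ is contained in exactly $n$ blocks and every block has exactly $m$ elements. The set $\mathcal{L}^{3}_{2}$ is ordered by inclusion, with set complement in $\{1,\dots,6\}$ as orthocomplementation. A state on $L$ is a map $s:L\to[0,1]$ with $s(1)=1$ and $s(x\vee y)=s(x)+s(y)$ whenever $x\perp y$.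 $S(L)$ is the convex set of all states on $L$, and $S_2(L)$ is the set of states taking values only in $\{0,1\}$ (two-valued states). A set $T\subset S_2(L)$ is full if for all $x,y\in L$: $x\le y$ if and only if $f(x)\le f(y)$ for all $f\in T$. A concrete logic on a set $\Omega$ is a subset $\mathcal{E}$ of the power set $\mathcal{P}(\Omega)$ such that $\Omega\in\mathcal{E}$; $x\in\mathcal{E}$ implies $\Omega\setminus x\in\mathcal{E}$; and $x,y\in\mathcal{E}$, $x\cap y=\emptyset$ imply $x\cup y\in\mathcal{E}$. A signed measure on a concrete logic $\mathcal{E}$ is a function $\mu:\mathcal{E}\to\mathbb{R}$ with $\mu(x\cup y)=\mu(x)+\mu(y)$ for all disjoint $x,y\in\mathcal{E}$. $\mathcal{E}$ is regular if every signed measure on $\mathcal{E}$ extends to a signed measure on $\mathcal{P}(\Omega)$. If $S_2(L)$ is full, then the sets $x'=\{\mu\in S_2(L)\mid \mu(x)=1\}$, $x\in L$, form a concrete logic $\mathcal{E}(L)$ on $\Omega=S_2(L)$, called the total representation of $L$. *)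

theory Defs
  imports Complex_Main "HOL-Library.FuncSet" "HOL-Algebra.Lattice" "HOL-Number_Theory.Cong"
begin

section \<open>Orthomodular posets\<close>

record 'a orthoposet = "'a gorder" +
  ocompl :: "'a \<Rightarrow> 'a"

definition orthogonal :: "('a, 'm) orthoposet_scheme \<Rightarrow> 'a \<Rightarrow> 'a \<Rightarrow> bool" where
  "orthogonal L x y \<longleftrightarrow> x \<sqsubseteq>\<^bsub>L\<^esub> ocompl L y"

text \<open>
  Meets and joins in HOL-Algebra are Hilbert choices and hence only meaningful once they are known
  to exist.  The complement laws and the existence of orthogonal joins are therefore stated with
  \<^const>\<open>is_glb\<close> and \<^const>\<open>is_lub\<close>; in the orthomodular law, the meet and
  the join exist by \<open>orthogonal_join_exists\<close> and order reversal.
\<close>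

locale orthomodular_poset =
  partial_order L + weak_partial_order_bottom L + weak_partial_order_top L
  for L :: "('a, 'm) orthoposet_scheme" (structure) +
  assumes ocompl_closed: "x \<in> carrier L \<Longrightarrow> ocompl L x \<in> carrier L"
    and ocompl_ocompl: "x \<in> carrier L \<Longrightarrow> ocompl L (ocompl L x) = x"
    and ocompl_antimono: "\<lbrakk>x \<in> carrier L; y \<in> carrier L; x \<sqsubseteq> y\<rbrakk> \<Longrightarrow> ocompl L y \<sqsubseteq> ocompl L x"
    and ocompl_meet: "x \<in> carrier L \<Longrightarrow> is_glb L \<bottom> {x, ocompl L x}"
    and ocompl_join: "x \<in> carrier L \<Longrightarrow> is_lub L \<top> {x, ocompl L x}"
    and orthogonal_join_exists:
      "\<lbrakk>x \<in> carrier L; y \<in> carrier L; orthogonal L x y\<rbrakk> \<Longrightarrow> \<exists>z. is_lub L z {x, y}"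
    and orthomodular:
      "\<lbrakk>x \<in> carrier L; y \<in> carrier L; x \<sqsubseteq> y\<rbrakk> \<Longrightarrow> y = x \<squnion> (y \<sqinter> ocompl L x)"

definition omp_isomorphic ::
  "('a, 'm) orthoposet_scheme \<Rightarrow> ('b, 'n) orthoposet_scheme \<Rightarrow> bool" where
  "omp_isomorphic L M \<longleftrightarrow>
    (\<exists>f. bij_betw f (carrier L) (carrier M) \<and> order_emb L M f \<and>
         (\<forall>x\<in>carrier L. f (ocompl L x) = ocompl M (f x)))"

definition atoms :: "('a, 'm) orthoposet_scheme \<Rightarrow> 'a set" where
  "atoms L = {a \<in> carrier L. a \<noteq> \<bottom>\<^bsub>L\<^esub> \<and>
     (\<forall>x\<in>carrier L. x \<sqsubseteq>\<^bsub>L\<^esub> a \<longrightarrow> x = \<bottom>\<^bsub>L\<^esub> \<or> x = a)}"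

definition orthogonal_atom_set :: "('a, 'm) orthoposet_scheme \<Rightarrow> 'a set \<Rightarrow> bool" where
  "orthogonal_atom_set L B \<longleftrightarrow> B \<subseteq> atoms L \<and> pairwise (orthogonal L) B"

definition blocks :: "('a, 'm) orthoposet_scheme \<Rightarrow> 'a set set" where
  "blocks L = {B. orthogonal_atom_set L B \<and> (\<forall>C. orthogonal_atom_set L C \<and> B \<subseteq> C \<longrightarrow> C = B)}"

text \<open>Only meaningful for finite \<open>L\<close>, because \<^const>\<open>card\<close> is \<open>0\<close> on infinite sets.\<close>

definition homogeneous :: "nat \<Rightarrow> nat \<Rightarrow> ('a, 'm) orthoposet_scheme \<Rightarrow> bool" where
  "homogeneous n m L \<longleftrightarrow>
    (\<forall>a\<in>atoms L. card {B \<in> blocks L. a \<in> B} = n) \<and> (\<forall>B\<in>blocks L. card B = m)"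

definition inclusion_logic :: "'a set \<Rightarrow> 'a set set \<Rightarrow> 'a set orthoposet" where
  "inclusion_logic \<Omega> \<E> = \<lparr>carrier = \<E>, eq = (=), le = (\<subseteq>), ocompl = (\<lambda>X. \<Omega> - X)\<rparr>"

definition L32 :: "nat set orthoposet" where
  "L32 = inclusion_logic {1..6} {X. X \<subseteq> {1..6} \<and> [card X = 0] (mod 2)}"


section \<open>States\<close>

text \<open>
  States are extensional functions (\<^const>\<open>undefined\<close> off the carrier), so that distinct HOL
  functions in \<open>states L\<close> are distinct as maps on \<open>L\<close>.
\<close>

definition states :: "('a, 'm) orthoposet_scheme \<Rightarrow> ('a \<Rightarrow> real) set" where
  "states L = {s \<in> carrier L \<rightarrow>\<^sub>E {0..1}. s \<top>\<^bsub>L\<^esub> = 1 \<and>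
     (\<forall>x\<in>carrier L. \<forall>y\<in>carrier L. orthogonal L x y \<longrightarrow> s (x \<squnion>\<^bsub>L\<^esub> y) = s x + s y)}"

definition two_valued_states :: "('a, 'm) orthoposet_scheme \<Rightarrow> ('a \<Rightarrow> real) set" where
  "two_valued_states L = {s \<in> states L. \<forall>x\<in>carrier L. s x \<in> {0, 1}}"

definition full_states :: "('a, 'm) orthoposet_scheme \<Rightarrow> ('a \<Rightarrow> real) set \<Rightarrow> bool" where
  "full_states L T \<longleftrightarrow> T \<subseteq> two_valued_states L \<and>
    (\<forall>x\<in>carrier L. \<forall>y\<in>carrier L. x \<sqsubseteq>\<^bsub>L\<^esub> y \<longleftrightarrow> (\<forall>f\<in>T. f x \<le> f y))"

definition mix ::
  "('a, 'm) orthoposet_scheme \<Rightarrow> real \<Rightarrow> ('a \<Rightarrow> real) \<Rightarrow> ('a \<Rightarrow> real) \<Rightarrow> 'a \<Rightarrow> real" where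
  "mix L u s t = (\<lambda>x\<in>carrier L. (1 - u) * s x + u * t x)"

lemma (in orthomodular_poset) mix_states:
  assumes s: "s \<in> states L" and t: "t \<in> states L" and u: "u \<in> {0..1}"
  shows "mix L u s t \<in> states L"
proof -
  have join_closed: "x \<squnion> y \<in> carrier L"
    if "x \<in> carrier L" "y \<in> carrier L" "orthogonal L x y" for x y
    using someI_ex[OF orthogonal_join_exists[OF that]]
    by (auto simp: join_def sup_def)
  have bounds: "(1 - u) * s x + u * t x \<in> {0..1}" if "x \<in> carrier L" for x
  proof -
    have st: "s x \<in> {0..1}" "t x \<in> {0..1}"
      using s t that by (auto simp: states_def PiE_def Pi_def)
    have "(1 - u) * s x + u * t x \<le> 1"
      using st u by (intro convex_bound_le) auto
    moreover have "0 \<le> (1 - u) * s x + u * t x"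
      using st u by simp
    ultimately show ?thesis by simp
  qed
  show ?thesis
    using s t join_closed bounds by (auto simp: states_def mix_def algebra_simps)
qed

definition affinely_isomorphic_states ::
  "('a, 'm) orthoposet_scheme \<Rightarrow> 'v::real_vector set \<Rightarrow> bool" where
  "affinely_isomorphic_states L C \<longleftrightarrow>
    (\<exists>\<phi>. bij_betw \<phi> (states L) C \<and>
         (\<forall>s\<in>states L. \<forall>t\<in>states L. \<forall>u\<in>{0..1}.
            \<phi> (mix L u s t) = (1 - u) *\<^sub>R \<phi> s + u *\<^sub>R \<phi> t))"


section \<open>Concrete logics\<close>

definition concrete_logic :: "'a set \<Rightarrow> 'a set set \<Rightarrow> bool" where
  "concrete_logic \<Omega> \<E> \<longleftrightarrow> \<E> \<subseteq> Pow \<Omega> \<and> \<Omega> \<in> \<E> \<and> (\<forall>x\<in>\<E>. \<Omega> - x \<in> \<E>) \<and>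
    (\<forall>x\<in>\<E>. \<forall>y\<in>\<E>. x \<inter> y = {} \<longrightarrow> x \<union> y \<in> \<E>)"

definition signed_measure :: "'a set set \<Rightarrow> ('a set \<Rightarrow> real) \<Rightarrow> bool" where
  "signed_measure \<E> \<mu> \<longleftrightarrow>
    (\<forall>x\<in>\<E>. \<forall>y\<in>\<E>. x \<inter> y = {} \<longrightarrow> \<mu> (x \<union> y) = \<mu> x + \<mu> y)"

definition regular_concrete_logic :: "'a set \<Rightarrow> 'a set set \<Rightarrow> bool" where
  "regular_concrete_logic \<Omega> \<E> \<longleftrightarrow> concrete_logic \<Omega> \<E> \<and>
    (\<forall>\<mu>. signed_measure \<E> \<mu> \<longrightarrow> (\<exists>\<nu>. signed_measure (Pow \<Omega>) \<nu> \<and> (\<forall>x\<in>\<E>. \<nu> x = \<mu> x)))"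

definition total_representation :: "('a, 'm) orthoposet_scheme \<Rightarrow> ('a \<Rightarrow> real) set set" where
  "total_representation L = (\<lambda>x. {\<mu> \<in> two_valued_states L. \<mu> x = 1}) ` carrier L"

end

(*
  In a finite orthomodular poset whose blocks have three elements, everything apart from 0 and 1 is
  an atom or the complement of an atom, and a <= b' between atoms says that a and b are orthogonal.
  Hence the poset is determined by the graph of orthogonality on its atoms, in which every edge lies
  in exactly one triangle; (3,3)-homogeneity says that this graph is 6-regular.  Conversely every
  such graph defines a logic, whose states are the weights on the points with sum 1 on triangles.

  15 atoms: a triangle together with its neighbours already exhausts the 15 points, so every point
  off a triangle is adjacent to exactly one of its vertices (a generalized quadrangle of order 2).
  The three common neighbours of two non-adjacent points have a third common neighbour, so there is
  a complete bipartite subgraph K(3,3).  The nine third points of its edges are the remaining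
  points, and all adjacencies are then those of disjointness between 2-subsets of {1,...,6}.

  17 atoms: the incidence matrix of the triangle-free configuration below has rank 16, with kernel
  vector of entries 0, 1, -1, so the weights form a segment around the constant 1/3.

  27 atoms: the points are those of the cube of side 3, the lines are the axis-parallel ones.  A
  two-valued state is a Latin square of order 3; the 12 of them are the affine planes over Z/3
  whose normal vector has no zero entry, and they span the 9-dimensional space of functions with
  constant line sums.
*)

theory Submission
  imports Defs
begin

section \<open>Graphs in which every edge lies in a unique triangle\<close>

definition duads :: "nat set set" where
  "duads = {X. X \<subseteq> {1..6} \<and> card X = 2}"

text \<open>With an explicit list, adjacency of all pairs of labels and the existence of disjoint
  duads can be settled by simplification in \<open>duad_labelling\<close>.\<close>

lemma duads_eq:
  "duads = {{1, 2}, {1, 3}, {1, 4}, {1, 5}, {1, 6},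
    {2, 3}, {2, 4}, {2, 5}, {2, 6},
    {3, 4}, {3, 5}, {3, 6},
    {4, 5}, {4, 6},
    {5, 6}}"
  (is "_ = ?D")
proof
  show "duads \<subseteq> ?D"
  proof
    fix X assume "X \<in> duads"
    then obtain i j where X: "X = {i, j}" "i \<noteq> j" "{i, j} \<subseteq> {1..6}"
      unfolding duads_def by (auto simp: card_2_iff)
    have "{1..6} = {1, 2, 3, 4, 5, 6::nat}"
      by auto
    then have "i \<in> {1, 2, 3, 4, 5, 6}" "j \<in> {1, 2, 3, 4, 5, 6}"
      using X(3) by auto
    then show "X \<in> ?D"
      using X(2) unfolding X(1)
      by (elim insertE emptyE; hypsubst; simp add: doubleton_eq_iff)
  qed
  show "?D \<subseteq> duads"
    by (auto simp: duads_def)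
qed

lemma card_duads: "card duads = 15"
proof -
  have "duads = {X. X \<subseteq> {1..6::nat} \<and> card X = 2}"
    by (simp add: duads_def)
  then show ?thesis
    using n_subsets[of "{1..6::nat}" 2] by (simp add: choose_two)
qed

section \<open>Graphs with a unique triangle on every edge, up to the 15-point case\<close>

locale unique_triangle_graph =
  fixes P :: "'a set" and adj :: "'a \<Rightarrow> 'a \<Rightarrow> bool"  (infix \<open>\<frown>\<close> 50)
  assumes finite_points: "finite P"
    and adj_point: "a \<frown> b \<Longrightarrow> a \<in> P"
    and adj_sym: "a \<frown> b \<Longrightarrow> b \<frown> a"
    and adj_irrefl: "\<not> a \<frown> a"
    and ex1_third: "a \<frown> b \<Longrightarrow> \<exists>!c. a \<frown> c \<and> b \<frown> c"
begin

definition third :: "'a \<Rightarrow> 'a \<Rightarrow> 'a" where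
  "third a b = (THE c. a \<frown> c \<and> b \<frown> c)"

definition triangles :: "'a set set" where
  "triangles = {{a, b, c} | a b c. a \<frown> b \<and> b \<frown> c \<and> a \<frown> c}"

lemma third_adj: "a \<frown> b \<Longrightarrow> a \<frown> third a b \<and> b \<frown> third a b"
  unfolding third_def by (rule theI') (rule ex1_third)

lemma third_unique: "\<lbrakk>a \<frown> b; a \<frown> c; b \<frown> c\<rbrakk> \<Longrightarrow> third a b = c"
  using ex1_third third_adj by blast

lemma third_commute: "a \<frown> b \<Longrightarrow> third a b = third b a"
  using third_unique third_adj adj_sym by metis

lemma adj_neq: "a \<frown> b \<Longrightarrow> a \<noteq> b"
  using adj_irrefl by blast

lemma adj_point2: "a \<frown> b \<Longrightarrow> b \<in> P"
  using adj_point adj_sym by blast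

lemma finite_nbrs: "finite {b. a \<frown> b}"
  using adj_point2 by (auto intro: finite_subset[OF _ finite_points])

text \<open>Any two vertices of \<open>{x, y, z}\<close> have the remaining one as
  \<open>third\<close>. So triangles behave like the lines of a partial linear space: two of them
  share at most one point.\<close>

lemma triangle_of_edge:
  assumes "T \<in> triangles" "a \<in> T" "b \<in> T" "a \<noteq> b"
  shows "a \<frown> b \<and> T = {a, b, third a b}"
proof -
  obtain x y z where T: "T = {x, y, z}" and xyz: "x \<frown> y" "y \<frown> z" "x \<frown> z"
    using assms(1) by (auto simp: triangles_def)
  have "y \<frown> x" "z \<frown> y" "z \<frown> x"
    using xyz adj_sym by auto
  moreover from this xyz have "third x y = z" "third y x = z" "third y z = x" "third z y = x"
    "third x z = y" "third z x = y"
    by (auto intro: third_unique)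
  ultimately show ?thesis
    using xyz assms(2-4) unfolding T by auto
qed

lemma edge_in_triangle: "a \<frown> b \<Longrightarrow> {a, b, third a b} \<in> triangles"
  using third_adj unfolding triangles_def by blast

lemma card_triangle: "T \<in> triangles \<Longrightarrow> card T = 3"
  unfolding triangles_def using adj_irrefl by auto (metis card_3_iff)

lemma finite_triangles: "finite triangles"
proof (rule finite_subset)
  show "triangles \<subseteq> Pow P"
    unfolding triangles_def using adj_point adj_point2 by auto
qed (simp add: finite_points)

text \<open>The sets \<open>T - {a}\<close> split the neighbours of \<open>a\<close> into disjoint
  pairs. Degree 6 thus means three triangles through each point.\<close>

lemma degree_eq: "card {b. a \<frown> b} = 2 * card {T \<in> triangles. a \<in> T}"
proof -
  let ?S = "{T \<in> triangles. a \<in> T}"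
  have "{b. a \<frown> b} = (\<Union>T\<in>?S. T - {a})"
  proof (intro equalityI subsetI)
    fix b assume "b \<in> {b. a \<frown> b}"
    then show "b \<in> (\<Union>T\<in>?S. T - {a})"
      using edge_in_triangle[of a b] adj_neq[of a b] by auto
  next
    fix b assume "b \<in> (\<Union>T\<in>?S. T - {a})"
    then show "b \<in> {b. a \<frown> b}"
      using triangle_of_edge by blast
  qed
  moreover have "card (\<Union>T\<in>?S. T - {a}) = (\<Sum>T\<in>?S. card (T - {a}))"
  proof (rule card_UN_disjoint)
    show "finite ?S" using finite_triangles by simp
    show "\<forall>T\<in>?S. finite (T - {a})"
      using card_triangle by (metis (no_types, lifting) card.infinite finite_Diff mem_Collect_eq zero_neq_numeral)
    show "\<forall>S\<in>?S. \<forall>T\<in>?S. S \<noteq> T \<longrightarrow> (S - {a}) \<inter> (T - {a}) = {}"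
      using triangle_of_edge by blast
  qed
  moreover have "card (T - {a}) = 2" if "T \<in> ?S" for T
    using that card_triangle by auto
  ultimately show ?thesis
    by simp
qed

text \<open>
  The generalized quadrangle axiom: a triangle and the pairwise disjoint sets of further neighbours
  of its vertices have \<open>3 + 3 * 4 = 15\<close> points in total.
\<close>
lemma triangle_meets_nbrs:
  assumes P15: "card P = 15" and deg: "\<forall>a\<in>P. card {b. a \<frown> b} = 6"
    and ab: "a \<frown> b" and x: "x \<in> P" "\<not> x \<frown> a" "\<not> x \<frown> b"
    and neq: "x \<noteq> a" "x \<noteq> b"
  shows "x \<frown> third a b \<or> x = third a b"
proof -
  define c where "c = third a b"
  have c: "a \<frown> c" "b \<frown> c"
    using third_adj[OF ab] by (auto simp: c_def)
  let ?N = "\<lambda>a. {b. a \<frown> b}"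
  have fin: "finite (?N a)" "finite (?N b)" "finite (?N c)"
    by (rule finite_nbrs)+
  have in3: "{b, c} \<subseteq> ?N a" "{a, c} \<subseteq> ?N b" "{a, b} \<subseteq> ?N c"
    using ab c adj_sym by auto
  have neqs: "a \<noteq> b" "a \<noteq> c" "b \<noteq> c" "b \<noteq> a" "c \<noteq> a" "c \<noteq> b"
    using ab c adj_neq by blast+
  have six: "card (?N a) = 6" "card (?N b) = 6" "card (?N c) = 6"
    using ab c deg adj_point adj_point2 by blast+
  let ?A = "?N a - {b, c}" and ?B = "?N b - {a, c}" and ?C = "?N c - {a, b}"
  have four: "card ?A = 4" "card ?B = 4" "card ?C = 4"
    using six in3 neqs by (simp_all add: card_Diff_subset)
  have u: "third a b = c" "third a c = b" "third b c = a"
    using ab c adj_sym by (auto intro!: third_unique)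
  \<comment> \<open>A common element of two of these sets would complete an edge of the triangle,
    hence be its remaining vertex, which has been removed.\<close>
  have "?A \<inter> ?B = {}" "?A \<inter> ?C = {}" "?B \<inter> ?C = {}"
    using third_unique[OF ab] third_unique[OF c(1)] third_unique[OF c(2)] u by auto
  then have "card (?A \<union> ?B \<union> ?C) = 12"
    using fin four by (simp add: card_Un_disjoint Int_Un_distrib2)
  moreover have "{a, b, c} \<inter> (?A \<union> ?B \<union> ?C) = {}"
    using adj_irrefl by auto
  ultimately have "card ({a, b, c} \<union> (?A \<union> ?B \<union> ?C)) = 15"
    using fin neqs by (subst card_Un_disjoint) auto
  moreover have "{a, b, c} \<union> (?A \<union> ?B \<union> ?C) \<subseteq> P"
    using ab c adj_point adj_point2 by blast
  ultimately have "{a, b, c} \<union> (?A \<union> ?B \<union> ?C) = P"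
    using finite_points P15 by (metis card_subset_eq)
  then show ?thesis
    using x neq adj_sym unfolding c_def by blast
qed

text \<open>Six neighbours mean three triangles through \<open>v\<close>, and the mutually
  non-adjacent points \<open>p\<close>, \<open>q\<close>, \<open>x\<close> occupy one each. A
  neighbour \<open>y\<close> off the triangles of \<open>p\<close> and \<open>q\<close> must lie on
  that of \<open>x\<close>.\<close>

lemma third_line:
  assumes deg: "\<forall>a\<in>P. card {b. a \<frown> b} = 6"
    and nbrs: "v \<frown> p" "v \<frown> q" "v \<frown> x" "v \<frown> y"
    and nonadj: "\<not> p \<frown> q" "\<not> p \<frown> x" "\<not> q \<frown> x" "\<not> p \<frown> y" "\<not> q \<frown> y"
    and neq: "p \<noteq> q" "p \<noteq> x" "q \<noteq> x" "p \<noteq> y" "q \<noteq> y"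
  shows "y = x \<or> x \<frown> y"
proof -
  let ?t = "third v"
  have t: "v \<frown> ?t p" "v \<frown> ?t q" "v \<frown> ?t x" "p \<frown> ?t p" "q \<frown> ?t q" "x \<frown> ?t x"
    using third_adj nbrs by auto
  \<comment> \<open>\<open>third v\<close> is an involution on the neighbours of \<open>v\<close>;
    being injective there, it keeps the three partners apart.\<close>
  have tt: "?t (?t p) = p" "?t (?t q) = q" "?t (?t x) = x"
    using t nbrs adj_sym by (auto intro!: third_unique)
  let ?S = "{p, ?t p, q, ?t q, x, ?t x}"
  have "p \<noteq> ?t p" "q \<noteq> ?t q" "x \<noteq> ?t x" "p \<noteq> ?t q" "p \<noteq> ?t x" "q \<noteq> ?t p" "q \<noteq> ?t x"
    "x \<noteq> ?t p" "x \<noteq> ?t q"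
    using t nonadj adj_irrefl adj_sym by metis+
  moreover have "?t p \<noteq> ?t q" "?t p \<noteq> ?t x" "?t q \<noteq> ?t x"
    using tt neq by metis+
  ultimately have "card ?S = 6"
    using neq by simp
  moreover have "?S \<subseteq> {b. v \<frown> b}"
    using nbrs t by auto
  moreover have "card {b. v \<frown> b} = 6"
    using deg adj_point nbrs(1) by blast
  ultimately have "?S = {b. v \<frown> b}"
    using finite_nbrs by (metis card_subset_eq)
  then have "y \<in> ?S"
    using nbrs by auto
  then show ?thesis
    using t nonadj neq by auto
qed

text \<open>One side consists of two non-adjacent points \<open>p\<close>, \<open>q\<close> and a
  further point \<open>r\<close>, the other of the three common neighbours of \<open>p\<close> and
  \<open>q\<close>. The index sets anticipate the symbols used in the duads.\<close>

lemma complete_bipartite_subgraph: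
  assumes P15: "card P = 15" and deg: "\<forall>a\<in>P. card {b. a \<frown> b} = 6"
  shows "\<exists>u v. (\<forall>i\<in>{1,2,3::nat}. \<forall>j\<in>{4,5,6::nat}. u i \<frown> v j) \<and>
    (\<forall>i\<in>{1,2,3}. \<forall>k\<in>{1,2,3}. \<not> u i \<frown> u k) \<and> (\<forall>j\<in>{4,5,6}. \<forall>l\<in>{4,5,6}. \<not> v j \<frown> v l) \<and>
    inj_on u {1,2,3} \<and> inj_on v {4,5,6}"
proof -
  note meets = triangle_meets_nbrs[OF P15 deg]
  obtain p where p: "p \<in> P"
    using P15 by (metis card.empty equals0I zero_neq_numeral)
  have "card ({p} \<union> {b. p \<frown> b}) = 7"
    using deg p finite_nbrs adj_irrefl by simp
  then have "{p} \<union> {b. p \<frown> b} \<noteq> P"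
    using P15 by auto
  then obtain q where q: "q \<in> P" "q \<noteq> p" "\<not> p \<frown> q"
    using p adj_point2 by auto
  have q': "\<not> q \<frown> p" using q adj_sym by blast
  define C where "C = {b. p \<frown> b \<and> q \<frown> b}"
  \<comment> \<open>On each triangle through \<open>p\<close> exactly one of the other two vertices
    is adjacent to \<open>q\<close>: at least one by \<open>meets\<close>, and not both, since
    \<open>p\<close> and \<open>q\<close> would then complete the same edge. So half of the six
    neighbours of \<open>p\<close> lie in \<open>C\<close>.\<close>
  have "bij_betw (third p) C ({b. p \<frown> b} - C)"
  proof (rule bij_betw_byWitness[where f' = "third p"])
    have inv: "third p (third p b) = b" if "p \<frown> b" for b
      using that third_adj adj_sym by (auto intro!: third_unique)
    show "\<forall>b\<in>C. third p (third p b) = b" "\<forall>b\<in>{b. p \<frown> b} - C. third p (third p b) = b"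
      using inv by (auto simp: C_def)
    show "third p ` C \<subseteq> {b. p \<frown> b} - C"
    proof
      fix c assume "c \<in> third p ` C"
      then obtain b where b: "p \<frown> b" "q \<frown> b" "c = third p b"
        by (auto simp: C_def)
      then have "p \<frown> c" "b \<frown> c"
        using third_adj by auto
      moreover have "\<not> q \<frown> c"
        using b q(2) \<open>b \<frown> c\<close> \<open>p \<frown> c\<close> adj_sym third_unique[of b c p] third_unique[of b c q] by metis
      ultimately show "c \<in> {b. p \<frown> b} - C"
        by (simp add: C_def)
    qed
    show "third p ` ({b. p \<frown> b} - C) \<subseteq> C"
    proof
      fix c assume "c \<in> third p ` ({b. p \<frown> b} - C)"
      then obtain b where b: "p \<frown> b" "\<not> q \<frown> b" "c = third p b"
        by (auto simp: C_def)
      then show "c \<in> C"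
        using meets[of p b q] q q' third_adj[of p b] by (auto simp: C_def)
    qed
  qed
  then have "card ({b. p \<frown> b} - C) = card C"
    by (metis bij_betw_same_card)
  moreover have "C \<subseteq> {b. p \<frown> b}" "finite C"
    using finite_nbrs[of p] by (auto simp: C_def)
  moreover have "card {b. p \<frown> b} = 6"
    using deg p by blast
  ultimately have "card C = 3"
    by (simp add: card_Diff_subset)
  then obtain v1 v2 v3 where C: "C = {v1, v2, v3}" "v1 \<noteq> v2" "v1 \<noteq> v3" "v2 \<noteq> v3"
    by (metis card_3_iff)
  have pv: "p \<frown> v1" "p \<frown> v2" "p \<frown> v3" and qv: "q \<frown> v1" "q \<frown> v2" "q \<frown> v3"
    using C(1) by (auto simp: C_def)
  \<comment> \<open>An edge inside \<open>C\<close> would be completed by both \<open>p\<close> and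
    \<open>q\<close>.\<close>
  have indep: "\<not> a \<frown> b" if "a \<in> C" "b \<in> C" for a b
    using that third_unique[of a b p] third_unique[of a b q] q(2) adj_sym by (auto simp: C_def)
  have v_nonadj: "\<not> v1 \<frown> v2" "\<not> v1 \<frown> v3" "\<not> v2 \<frown> v3" "\<not> v2 \<frown> v1" "\<not> v3 \<frown> v1" "\<not> v3 \<frown> v2"
    using indep C(1) by auto
  \<comment> \<open>If \<open>x\<close> were adjacent to \<open>p\<close>, both \<open>a\<close> and
    \<open>b\<close> would complete that edge; likewise for \<open>q\<close>.\<close>
  have nonadj2: "\<not> x \<frown> p \<and> \<not> x \<frown> q" if "a \<in> C" "b \<in> C" "a \<noteq> b" "x \<frown> a" "x \<frown> b" for x a b
    using that third_unique[of x p a] third_unique[of x p b] third_unique[of x q a]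
      third_unique[of x q b] by (auto simp: C_def)
  text \<open>
    Each \<open>v\<^sub>i\<close> has one more line besides those through \<open>p\<close> and \<open>q\<close>. Any two of these three lines
    meet, and if they were not concurrent they would form a forbidden triangle.
  \<close>
  have ex: "\<exists>r. r \<frown> v1 \<and> r \<frown> v2 \<and> r \<frown> v3 \<and> r \<noteq> p \<and> r \<noteq> q"
  proof -
    have concur: "\<exists>r. r \<frown> v1 \<and> r \<frown> v2 \<and> r \<frown> v3 \<and> r \<noteq> p \<and> r \<noteq> q"
      if y: "v1 \<frown> y" "v1 \<frown> y'" "y \<frown> y'" "v2 \<frown> y" "v3 \<frown> y'"
        and y_nonadj: "\<not> p \<frown> y" "\<not> q \<frown> y" "\<not> p \<frown> y'" "\<not> q \<frown> y'"
        and y_neq: "y \<noteq> p" "y \<noteq> q" "y' \<noteq> p" "y' \<noteq> q"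
      for y y'
    proof (cases "v3 \<frown> y")
      case True
      then show ?thesis
        using y y_neq adj_sym by blast
    next
      case False
      \<comment> \<open>This case is impossible. The point \<open>t\<close> turns out to be adjacent
        to \<open>v3\<close>, so by \<open>third_line\<close> at \<open>v3\<close> it equals
        \<open>y'\<close> or is adjacent to it. Equality lets both \<open>v1\<close> and
        \<open>v2\<close> complete the edge from \<open>y\<close> to \<open>y'\<close>; adjacency
        gives \<open>t = v1\<close>, although \<open>v2\<close> is adjacent to \<open>t\<close> but
        not to \<open>v1\<close>.\<close>
      define t where "t = third v2 y"
      have t: "v2 \<frown> t" "y \<frown> t"
        using third_adj[OF y(4)] by (auto simp: t_def)
      have "v3 \<in> P" "v3 \<noteq> v2" "v3 \<noteq> y" "v3 \<noteq> t"
        using pv(3) adj_point2 C y(4) v_nonadj t by auto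
      then have v3t: "v3 \<frown> t"
        using meets[OF y(4), of v3] False v_nonadj by (auto simp: t_def)
      have "\<not> t \<frown> p" "\<not> t \<frown> q"
        using nonadj2[of v2 v3 t] t(1) v3t adj_sym C by auto
      then have t': "\<not> p \<frown> t" "\<not> q \<frown> t" "t \<noteq> p" "t \<noteq> q"
        using adj_sym t(2) y_nonadj by blast+
      have "t = y' \<or> y' \<frown> t"
        by (rule third_line[OF deg, of v3 p q])
           (use v3t t' y y_nonadj y_neq pv qv q adj_sym in auto)
      moreover have "third y y' = v1"
        using y adj_sym by (intro third_unique) auto
      ultimately show ?thesis
        using third_unique[of y y' v2] third_unique[of y y' t] t y v_nonadj C(2) adj_sym by metis
    qed
    \<comment> \<open>The triangles through \<open>p\<close> and through \<open>q\<close> use up at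
      most four of the six neighbours of \<open>v1\<close>, so \<open>x\<close> lies on the
      remaining one.\<close>
    have "card {p, third v1 p, q, third v1 q} \<le> 4"
      by (intro order.trans[OF card_insert_le_m1]) auto
    moreover have "card {b. v1 \<frown> b} = 6"
      using deg adj_point2 pv(1) by blast
    ultimately have "\<not> {b. v1 \<frown> b} \<subseteq> {p, third v1 p, q, third v1 q}"
      using card_mono[of "{p, third v1 p, q, third v1 q}" "{b. v1 \<frown> b}"] by auto
    then obtain x where x: "v1 \<frown> x" "x \<noteq> p" "x \<noteq> third v1 p" "x \<noteq> q" "x \<noteq> third v1 q"
      by auto
    define x' where "x' = third v1 x"
    have x': "v1 \<frown> x'" "x \<frown> x'" "x' \<frown> x"
      using third_adj[OF x(1)] adj_sym by (auto simp: x'_def)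
    have nonadj: "\<not> p \<frown> x" "\<not> q \<frown> x" "\<not> p \<frown> x'" "\<not> q \<frown> x'" and neq': "x' \<noteq> p" "x' \<noteq> q"
      using x x' third_unique[of v1 p x] third_unique[of v1 q x] third_unique[of v1 x' p]
        third_unique[of v1 x' q] third_unique[of v1 x' x] third_unique[of p v1 x]
        third_unique[of q v1 x] third_commute pv qv adj_sym by metis+
    \<comment> \<open>The triangle \<open>v1\<close>, \<open>x\<close>, \<open>x'\<close> is met by
      both \<open>v2\<close> and \<open>v3\<close>, and not at \<open>v1\<close>. If they meet it at
      the same point, that point is \<open>r\<close>; otherwise \<open>concur\<close>
      applies.\<close>
    have "v2 \<frown> x \<or> v2 \<frown> x'"
      using meets[OF x(1), of v2] adj_point2[OF pv(2)] x x' v_nonadj C(2) by (auto simp: x'_def)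
    moreover have "v3 \<frown> x \<or> v3 \<frown> x'"
      using meets[OF x(1), of v3] adj_point2[OF pv(3)] x x' v_nonadj C(3) by (auto simp: x'_def)
    ultimately consider "v2 \<frown> x" "v3 \<frown> x" | "v2 \<frown> x" "v3 \<frown> x'" | "v2 \<frown> x'" "v3 \<frown> x" |
      "v2 \<frown> x'" "v3 \<frown> x'"
      by blast
    then show ?thesis
    proof cases
      case 1
      then show ?thesis using x adj_sym by blast
    next
      case 2
      then show ?thesis using concur[of x x'] x x' nonadj neq' by blast
    next
      case 3
      then show ?thesis using concur[of x' x] x x' nonadj neq' by blast
    next
      case 4
      then show ?thesis using x' neq' adj_sym by blast
    qed
  qed
  then obtain r where r: "r \<frown> v1" "r \<frown> v2" "r \<frown> v3" "r \<noteq> p" "r \<noteq> q"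
    by blast
  have "\<not> r \<frown> p" "\<not> r \<frown> q"
    using nonadj2[of v1 v2 r] r C by auto
  then have r': "\<not> r \<frown> p" "\<not> r \<frown> q" "\<not> p \<frown> r" "\<not> q \<frown> r"
    using adj_sym by auto
  show ?thesis
    using pv qv r r' q q' C v_nonadj adj_irrefl
    by (intro exI[of _ "\<lambda>i. if i = 1 then p else if i = 2 then q else r"]
          exI[of _ "\<lambda>i. if i = 4 then v1 else if i = 5 then v2 else v3"]) (auto simp: inj_on_def)
qed

text \<open>The 3 + 3 points \<open>u i\<close>, \<open>v j\<close> and the nine points
  \<open>m i j\<close> receive the fifteen duads. All adjacencies among them are forced, and
  bijectivity is deduced from the adjacencies afterwards.\<close>

lemma duad_labelling:
  assumes P15: "card P = 15" and deg: "\<forall>a\<in>P. card {b. a \<frown> b} = 6"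
  shows "\<exists>F. bij_betw F duads P \<and> (\<forall>X\<in>duads. \<forall>Y\<in>duads. F X \<frown> F Y \<longleftrightarrow> X \<inter> Y = {})"
proof -
  obtain u v :: "nat \<Rightarrow> 'a"
    where uv': "\<forall>i\<in>{1,2,3}. \<forall>j\<in>{4,5,6}. u i \<frown> v j"
      and uu': "\<forall>i\<in>{1,2,3}. \<forall>k\<in>{1,2,3}. \<not> u i \<frown> u k"
      and vv': "\<forall>j\<in>{4,5,6}. \<forall>l\<in>{4,5,6}. \<not> v j \<frown> v l"
      and inj: "inj_on u {1,2,3}" "inj_on v {4,5,6}"
    using complete_bipartite_subgraph[OF P15 deg] by (elim exE conjE)
  note uv = uv'[THEN bspec, THEN bspec] and uu = uu'[THEN bspec, THEN bspec]
    and vv = vv'[THEN bspec, THEN bspec]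
  have vu: "v j \<frown> u i" if "i \<in> {1,2,3}" "j \<in> {4,5,6}" for i j
    using uv that adj_sym by blast
  define m where "m i j = third (u i) (v j)" for i j
  have um: "u i \<frown> m i j" and vm: "v j \<frown> m i j" if "i \<in> {1,2,3}" "j \<in> {4,5,6}" for i j
    using third_adj uv that by (auto simp: m_def)
  have um_iff: "u k \<frown> m i j \<longleftrightarrow> k = i" if "i \<in> {1,2,3}" "j \<in> {4,5,6}" "k \<in> {1,2,3}" for i j k
  proof
    assume "u k \<frown> m i j"
    then have "third (v j) (m i j) = u k"
      using that vm vu adj_sym by (intro third_unique) auto
    moreover have "third (v j) (m i j) = u i"
      using that vm um vu adj_sym by (intro third_unique) auto
    ultimately show "k = i"
      using inj(1) that by (auto dest: inj_onD)
  qed (use that um in blast)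
  have vm_iff: "v l \<frown> m i j \<longleftrightarrow> l = j" if "i \<in> {1,2,3}" "j \<in> {4,5,6}" "l \<in> {4,5,6}" for i j l
  proof
    assume "v l \<frown> m i j"
    then have "third (u i) (m i j) = v l"
      using that um uv adj_sym by (intro third_unique) auto
    moreover have "third (u i) (m i j) = v j"
      using that vm um uv adj_sym by (intro third_unique) auto
    ultimately show "l = j"
      using inj(2) that by (auto dest: inj_onD)
  qed (use that vm in blast)
  have mm_iff: "m i j \<frown> m k l \<longleftrightarrow> i \<noteq> k \<and> j \<noteq> l"
    if ij: "i \<in> {1,2,3}" "j \<in> {4,5,6}" and kl: "k \<in> {1,2,3}" "l \<in> {4,5,6}" for i j k l
  proof
    assume adj: "m i j \<frown> m k l"
    \<comment> \<open>For \<open>i = k\<close> both \<open>v j\<close> and \<open>m k l\<close>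
      would complete the edge from \<open>u i\<close> to \<open>m i j\<close>; then
      \<open>v l\<close>, being adjacent to \<open>m k l\<close>, would be adjacent to
      \<open>v j\<close>.\<close>
    have "i \<noteq> k"
    proof
      assume "i = k"
      then have "v j = m k l"
        using third_unique[of "u i" "m i j" "v j"] third_unique[of "u i" "m i j" "m k l"]
          adj um[OF ij] um[OF kl] uv[OF ij] vm[OF ij] adj_sym by metis
      then show False
        using vm[OF kl] vv[OF kl(2) ij(2)] by simp
    qed
    moreover have "j \<noteq> l"
    proof
      assume "j = l"
      then have "u i = m k l"
        using third_unique[of "v j" "m i j" "u i"] third_unique[of "v j" "m i j" "m k l"]
          adj vm[OF ij] vm[OF kl] vu[OF ij] um[OF ij] adj_sym by metis
      then show False
        using um[OF kl] uu[OF kl(1) ij(1)] by simp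
    qed
    ultimately show "i \<noteq> k \<and> j \<noteq> l" ..
  next
    assume neq: "i \<noteq> k \<and> j \<noteq> l"
    \<comment> \<open>\<open>m i j\<close> misses two vertices of the triangle \<open>u k\<close>,
      \<open>v l\<close>, \<open>m k l\<close>, so the quadrangle axiom leaves only the
      third.\<close>
    have "\<not> m i j \<frown> u k" "\<not> m i j \<frown> v l"
      using um_iff[OF ij kl(1)] vm_iff[OF ij kl(2)] neq adj_sym by metis+
    moreover from this have "m i j \<noteq> u k" "m i j \<noteq> v l" "m i j \<noteq> m k l"
      using uv[OF ij(1) kl(2)] vu[OF kl(1) ij(2)] um[OF ij] vm[OF ij] um[OF kl]
        uu[OF kl(1) ij(1)] vv[OF kl(2) ij(2)] adj_sym by metis+
    ultimately show "m i j \<frown> m k l"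
      using triangle_meets_nbrs[OF P15 deg uv[OF kl], of "m i j"] adj_point2[OF um[OF ij]]
      by (auto simp: m_def)
  qed
  have mu_iff: "m i j \<frown> u k \<longleftrightarrow> k = i" if "i \<in> {1,2,3}" "j \<in> {4,5,6}" "k \<in> {1,2,3}" for i j k
    using um_iff[OF that] adj_sym by blast
  have mv_iff: "m i j \<frown> v l \<longleftrightarrow> l = j" if "i \<in> {1,2,3}" "j \<in> {4,5,6}" "l \<in> {4,5,6}" for i j l
    using vm_iff[OF that] adj_sym by blast
  text \<open>
    \<open>u i\<close> is labelled by the complement of \<open>i\<close> in \<open>{1,2,3}\<close>, \<open>v j\<close> by the complement of \<open>j\<close> in
    \<open>{4,5,6}\<close>, and \<open>m i j\<close> by \<open>{i, j}\<close>.
  \<close>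
  define F where "F X = (if X \<subseteq> {1,2,3} then u (6 - \<Sum>X) else if X \<subseteq> {4,5,6} then v (15 - \<Sum>X)
    else m (Min X) (Max X))" for X
  \<comment> \<open>Since 1 + 2 + 3 = 6 and 4 + 5 + 6 = 15, the differences in \<open>F\<close> name
    the symbol missing from the duad. A mixed duad has its minimum in \<open>{1,2,3}\<close> and its
    maximum in \<open>{4,5,6}\<close>.\<close>
  have F_adj: "F X \<frown> F Y \<longleftrightarrow> X \<inter> Y = {}" if "X \<in> duads" "Y \<in> duads" for X Y
  proof -
    have "\<forall>X\<in>duads. \<forall>Y\<in>duads. F X \<frown> F Y \<longleftrightarrow> X \<inter> Y = {}"
      unfolding duads_eq F_def
      by (simp add: uv vu uu vv um_iff vm_iff mu_iff mv_iff mm_iff)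
    then show ?thesis
      using that by blast
  qed
  \<comment> \<open>Distinct duads have different sets of disjoint duads, so \<open>F_adj\<close>
    makes \<open>F\<close> injective.\<close>
  have separated: "\<exists>Z\<in>duads. X \<inter> Z = {} \<and> Y \<inter> Z \<noteq> {}"
    if XY: "X \<in> duads" "Y \<in> duads" "X \<noteq> Y" for X Y
  proof -
    have "\<not> Y \<subseteq> X"
    proof
      assume "Y \<subseteq> X"
      moreover have "finite X" "card Y = card X"
        using XY finite_subset by (auto simp: duads_def)
      ultimately show False
        using card_subset_eq XY(3) by blast
    qed
    then obtain y where y: "y \<in> Y" "y \<notin> X"
      by blast
    then have "y \<in> {1..6}"
      using XY by (auto simp: duads_def)
    have "card ({1..6} - X - {y}) = 3"
      using XY y \<open>y \<in> {1..6}\<close> by (auto simp: duads_def card_Diff_subset finite_subset)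
    then obtain z where "z \<in> {1..6} - X - {y}"
      by (metis card.empty equals0I zero_neq_numeral)
    then show ?thesis
      using y \<open>y \<in> {1..6}\<close> by (intro bexI[of _ "{y, z}"]) (auto simp: duads_def)
  qed
  \<comment> \<open>Membership of \<open>F X\<close> in \<open>P\<close> is read off from an
    adjacency, and a duad disjoint from \<open>X\<close> supplies one.\<close>
  have disjoint_duad: "\<exists>Z\<in>duads. X \<inter> Z = {}" if "X \<in> duads" for X
  proof -
    have "\<forall>X\<in>duads. \<exists>Z\<in>duads. X \<inter> Z = {}"
      unfolding duads_eq by simp
    then show ?thesis
      using that by blast
  qed
  have "inj_on F duads"
    by (rule inj_onI) (metis F_adj separated)
  moreover have "F ` duads \<subseteq> P"
  proof
    fix a assume "a \<in> F ` duads"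
    then obtain X where X: "X \<in> duads" "a = F X"
      by blast
    then obtain Z where "Z \<in> duads" "X \<inter> Z = {}"
      using disjoint_duad by blast
    then show "a \<in> P"
      using F_adj X adj_point by blast
  qed
  ultimately have "bij_betw F duads P"
    using card_duads P15 finite_points by (metis bij_betw_def card_image card_subset_eq)
  then show ?thesis
    using F_adj by blast
qed

end

section \<open>Orthomodular posets with three-element blocks\<close>

lemma (in partial_order) join_eqI: "is_lub L z {x, y} \<Longrightarrow> x \<squnion> y = z"
  unfolding join_def sup_def by (metis (mono_tags, lifting) least_unique someI)

lemma (in partial_order) meet_eqI: "is_glb L z {x, y} \<Longrightarrow> x \<sqinter> y = z"
  unfolding meet_def inf_def by (metis (mono_tags, lifting) greatest_unique someI)

context orthomodular_poset
begin

lemma orthogonal_sym: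
  "\<lbrakk>x \<in> carrier L; y \<in> carrier L; orthogonal L x y\<rbrakk> \<Longrightarrow> orthogonal L y x"
  unfolding orthogonal_def
  using ocompl_antimono[of x "ocompl L y"] ocompl_closed ocompl_ocompl by simp

lemma ocompl_bottom: "ocompl L \<bottom> = \<top>"
proof (rule le_antisym)
  show "\<top> \<sqsubseteq> ocompl L \<bottom>"
    using ocompl_antimono[OF bottom_closed ocompl_closed[OF top_closed] bottom_lower]
      ocompl_closed[OF top_closed] by (simp add: ocompl_ocompl)
qed (simp_all add: ocompl_closed)

lemma ocompl_top: "ocompl L \<top> = \<bottom>"
  using ocompl_bottom ocompl_ocompl bottom_closed by metis

lemma ocompl_inject:
  "\<lbrakk>x \<in> carrier L; y \<in> carrier L\<rbrakk> \<Longrightarrow> ocompl L x = ocompl L y \<longleftrightarrow> x = y"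
  using ocompl_ocompl by metis

lemma orthogonal_lub:
  assumes "x \<in> carrier L" "y \<in> carrier L" "orthogonal L x y"
  shows "is_lub L (x \<squnion> y) {x, y}"
  unfolding join_def sup_def using orthogonal_join_exists[OF assms] by (rule someI_ex)

text \<open>If zero were the only common lower bound of \<open>y\<close> and the complement of
  \<open>x\<close>, it would be their meet, and the orthomodular law would collapse to
  \<open>y = x\<close>.\<close>

lemma nonzero_relative_complement:
  assumes xy: "x \<in> carrier L" "y \<in> carrier L" "x \<sqsubseteq> y" "x \<noteq> y"
  obtains z where "z \<in> carrier L" "z \<noteq> \<bottom>" "z \<sqsubseteq> y" "z \<sqsubseteq> ocompl L x"
proof (rule ccontr)
  assume neg: "\<not> thesis"
  have "z = \<bottom>" if "z \<in> carrier L" "z \<sqsubseteq> y" "z \<sqsubseteq> ocompl L x" for z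
    using neg that \<open>\<And>z. \<lbrakk>z \<in> carrier L; z \<noteq> \<bottom>; z \<sqsubseteq> y; z \<sqsubseteq> ocompl L x\<rbrakk> \<Longrightarrow> thesis\<close> by blast
  then have "is_glb L \<bottom> {y, ocompl L x}"
    using xy ocompl_closed by (auto simp: greatest_def Lower_def)
  then have "y \<sqinter> ocompl L x = \<bottom>"
    by (rule meet_eqI)
  moreover have "is_lub L x {x, \<bottom>}"
    using xy by (auto simp: least_def Upper_def)
  then have "x \<squnion> \<bottom> = x"
    by (rule join_eqI)
  ultimately show False
    using orthomodular[OF xy(1-3)] xy(4) by simp
qed

lemma atom_closed: "a \<in> atoms L \<Longrightarrow> a \<in> carrier L"
  by (simp add: atoms_def)

lemma atom_not_self_orthogonal:
  assumes a: "a \<in> atoms L"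
  shows "\<not> orthogonal L a a"
proof
  assume "orthogonal L a a"
  then have "a \<in> Lower L {a, ocompl L a}"
    using a by (auto simp: orthogonal_def Lower_def atoms_def)
  then have "a \<sqsubseteq> \<bottom>"
    using ocompl_meet[OF atom_closed[OF a]] by (auto simp: greatest_def)
  then show False
    using a bottom_lower[of a] le_antisym[of a \<bottom>] by (auto simp: atoms_def)
qed

lemma atom_below:
  assumes fin: "finite (carrier L)" and x: "x \<in> carrier L" "x \<noteq> \<bottom>"
  shows "\<exists>a\<in>atoms L. a \<sqsubseteq> x"
  using x
proof (induction "card {y \<in> carrier L. y \<sqsubseteq> x}" arbitrary: x rule: less_induct)
  case less
  show ?case
  proof (cases "x \<in> atoms L")
    case True
    then show ?thesis using less.prems by auto
  next
    case False
    then obtain y where y: "y \<in> carrier L" "y \<sqsubseteq> x" "y \<noteq> \<bottom>" "y \<noteq> x"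
      using less.prems by (auto simp: atoms_def)
    have "\<not> x \<sqsubseteq> y"
      using y less.prems le_antisym by blast
    then have "{z \<in> carrier L. z \<sqsubseteq> y} \<subset> {z \<in> carrier L. z \<sqsubseteq> x}"
      using le_trans[OF _ y(2) _ y(1) less.prems(1)] y less.prems by auto
    then have "card {z \<in> carrier L. z \<sqsubseteq> y} < card {z \<in> carrier L. z \<sqsubseteq> x}"
      using fin by (intro psubset_card_mono) auto
    from less.hyps[OF this y(1,3)] obtain a where a: "a \<in> atoms L" "a \<sqsubseteq> y"
      by blast
    then have "a \<sqsubseteq> x"
      using le_trans[OF a(2) y(2) atom_closed] y(1) less.prems(1) by blast
    then show ?thesis
      using a(1) by blast
  qed
qed

lemma orthogonal_set_in_block:
  assumes fin: "finite (carrier L)" and B: "orthogonal_atom_set L B"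
  shows "\<exists>C\<in>blocks L. B \<subseteq> C"
proof -
  have "finite {C. orthogonal_atom_set L C}"
    using fin by (rule_tac finite_subset[of _ "Pow (carrier L)"])
      (auto simp: orthogonal_atom_set_def atoms_def)
  from finite_has_maximal2[OF this, of B] B show ?thesis
    by (auto simp: blocks_def)
qed

lemma orthogonal_atom_set_insert:
  assumes "orthogonal_atom_set L B" "d \<in> atoms L" "\<forall>b\<in>B. orthogonal L d b"
  shows "orthogonal_atom_set L (insert d B)"
proof -
  have "orthogonal L b d" if "b \<in> B" for b
    using that assms orthogonal_sym atom_closed by (auto simp: orthogonal_atom_set_def)
  then show ?thesis
    using assms by (auto simp: orthogonal_atom_set_def pairwise_insert)
qed

end

section \<open>Finite orthomodular posets with three-element blocks\<close>

locale three_block_omp = orthomodular_poset +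
  assumes finite_carrier: "finite (carrier L)"
    and card_block: "B \<in> blocks L \<Longrightarrow> card B = 3"
begin

definition atom_adj :: "'a \<Rightarrow> 'a \<Rightarrow> bool"  (infix \<open>\<frown>\<close> 50) where
  "a \<frown> b \<longleftrightarrow> a \<in> atoms L \<and> b \<in> atoms L \<and> orthogonal L a b"

lemma block_adj: "\<lbrakk>B \<in> blocks L; x \<in> B; y \<in> B; x \<noteq> y\<rbrakk> \<Longrightarrow> x \<frown> y"
  unfolding blocks_def orthogonal_atom_set_def pairwise_def atom_adj_def by blast

lemma atom_adj_sym: "a \<frown> b \<Longrightarrow> b \<frown> a"
  using orthogonal_sym atom_closed by (auto simp: atom_adj_def)

lemma atom_adj_irrefl: "\<not> a \<frown> a"
  using atom_not_self_orthogonal by (auto simp: atom_adj_def)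

lemma orthogonal_triple_block:
  assumes "a \<frown> b" "b \<frown> c" "a \<frown> c"
  shows "{a, b, c} \<in> blocks L"
proof -
  have "orthogonal_atom_set L {a, b, c}"
    using assms atom_adj_sym by (auto simp: orthogonal_atom_set_def pairwise_def atom_adj_def)
  then obtain C where C: "C \<in> blocks L" "{a, b, c} \<subseteq> C"
    using orthogonal_set_in_block[OF finite_carrier] by blast
  have "a \<noteq> b" "b \<noteq> c" "a \<noteq> c"
    using assms atom_adj_irrefl by auto
  then have "card {a, b, c} = card C"
    using card_block[OF C(1)] by simp
  moreover have "finite C"
    using card_block[OF C(1)] card.infinite by force
  ultimately show ?thesis
    using C card_subset_eq by metis
qed

text \<open>The join of \<open>a\<close> and \<open>b\<close> is the complement of \<open>c\<close>.
  Otherwise the gap between them would contain a nonzero element, hence an atom orthogonal to all of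
  \<open>a\<close>, \<open>b\<close>, \<open>c\<close>, against the maximality of the block.\<close>

lemma join_in_triple:
  assumes abc: "a \<frown> b" "b \<frown> c" "a \<frown> c"
    and y: "y \<in> carrier L" "a \<sqsubseteq> y" "b \<sqsubseteq> y"
  shows "ocompl L c \<sqsubseteq> y"
proof -
  have closed: "a \<in> carrier L" "b \<in> carrier L" "c \<in> carrier L" "ocompl L c \<in> carrier L"
    using abc atom_closed ocompl_closed by (auto simp: atom_adj_def)
  let ?j = "a \<squnion> b"
  have lub: "is_lub L ?j {a, b}"
    using abc closed orthogonal_lub by (auto simp: atom_adj_def)
  then have j: "?j \<in> carrier L" "a \<sqsubseteq> ?j" "b \<sqsubseteq> ?j"
    using closed by (auto simp: least_def Upper_def)
  have least: "?j \<sqsubseteq> z" if "z \<in> carrier L" "a \<sqsubseteq> z" "b \<sqsubseteq> z" for z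
    using lub that closed by (auto simp: least_def Upper_def)
  have "?j = ocompl L c"
  proof (rule ccontr)
    assume "?j \<noteq> ocompl L c"
    moreover have "?j \<sqsubseteq> ocompl L c"
      using abc closed by (intro least) (auto simp: atom_adj_def orthogonal_def)
    ultimately obtain z where z: "z \<in> carrier L" "z \<noteq> \<bottom>" "z \<sqsubseteq> ocompl L c" "z \<sqsubseteq> ocompl L ?j"
      using nonzero_relative_complement j closed by metis
    obtain d where d: "d \<in> atoms L" "d \<sqsubseteq> z"
      using atom_below[OF finite_carrier z(1,2)] by blast
    have dc: "d \<in> carrier L"
      using d atom_closed by blast
    have dj: "d \<sqsubseteq> ocompl L ?j" and "d \<sqsubseteq> ocompl L c"
      using le_trans[OF d(2) z(4)] le_trans[OF d(2) z(3)] z(1) dc j closed ocompl_closed by auto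
    moreover have "ocompl L ?j \<sqsubseteq> ocompl L a" "ocompl L ?j \<sqsubseteq> ocompl L b"
      using j closed ocompl_antimono by auto
    ultimately have d_orth: "\<forall>b\<in>{a, b, c}. orthogonal L d b"
      using le_trans[OF dj] dc j closed ocompl_closed by (auto simp: orthogonal_def)
    have block: "{a, b, c} \<in> blocks L"
      using orthogonal_triple_block abc by blast
    then have "orthogonal_atom_set L (insert d {a, b, c})"
      using orthogonal_atom_set_insert[OF _ d(1) d_orth] by (auto simp: blocks_def)
    then have "insert d {a, b, c} = {a, b, c}"
      using block unfolding blocks_def by blast
    then show False
      using d_orth d(1) atom_not_self_orthogonal by blast
  qed
  then show ?thesis
    using least[OF y] by simp
qed

lemma ex_block_of_atom:
  assumes a: "a \<in> atoms L"
  obtains b c where "a \<frown> b" "b \<frown> c" "a \<frown> c"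
proof -
  have "orthogonal_atom_set L {a}"
    using a by (auto simp: orthogonal_atom_set_def)
  then obtain C where C: "C \<in> blocks L" "a \<in> C"
    using orthogonal_set_in_block[OF finite_carrier] by blast
  then have "card (C - {a}) = 2"
    using card_block by auto
  then obtain b c where bc: "C - {a} = {b, c}" "b \<noteq> c"
    by (auto simp: card_2_iff)
  then have "C = {a, b, c}" "a \<noteq> b" "a \<noteq> c"
    using C by auto
  then have "a \<frown> b" "b \<frown> c" "a \<frown> c"
    using C(1) bc(2) block_adj by blast+
  then show ?thesis
    by (rule that)
qed

text \<open>An orthogonal pair of atoms extends to a block, whose third atom is a common neighbour.
  It is the only one, since the complement of any common neighbour is the join of the pair.\<close>

sublocale orthogonality: unique_triangle_graph "atoms L" "(\<frown>)"
proof
  show "finite (atoms L)"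
    using finite_carrier by (auto simp: atoms_def)
  show "\<exists>!c. a \<frown> c \<and> b \<frown> c" if ab: "a \<frown> b" for a b
  proof -
    have "orthogonal_atom_set L {a, b}"
      using ab atom_adj_sym by (auto simp: orthogonal_atom_set_def pairwise_def atom_adj_def)
    then obtain C where C: "C \<in> blocks L" "{a, b} \<subseteq> C"
      using orthogonal_set_in_block[OF finite_carrier] by blast
    moreover have "a \<noteq> b"
      using ab atom_adj_irrefl by auto
    ultimately have "card (C - {a, b}) = 1"
      using card_block[of C] by (simp add: card_Diff_subset)
    then obtain c where "C - {a, b} = {c}"
      by (auto simp: card_1_singleton_iff)
    then have "c \<in> C" "c \<noteq> a" "c \<noteq> b"
      by blast+
    then have c: "a \<frown> c \<and> b \<frown> c"
      using C block_adj by blast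
    moreover have "d = c" if d: "a \<frown> d \<and> b \<frown> d" for d
    proof -
      have le: "ocompl L c \<sqsubseteq> ocompl L d" if "a \<frown> c" "b \<frown> c" "a \<frown> d" "b \<frown> d" for c d
        using that ab by (intro join_in_triple[of a b c])
          (auto simp: atom_adj_def orthogonal_def atom_closed ocompl_closed)
      have "ocompl L c = ocompl L d"
        using le[of c d] le[of d c] c d
        by (auto simp: atom_adj_def atom_closed ocompl_closed intro: le_antisym)
      then show ?thesis
        using c d by (auto simp: atom_adj_def atom_closed ocompl_inject)
    qed
    ultimately show ?thesis
      by blast
  qed
qed (use atom_adj_sym atom_adj_irrefl in \<open>auto simp: atom_adj_def\<close>)

lemma blocks_eq_triangles: "blocks L = orthogonality.triangles"
proof
  show "blocks L \<subseteq> orthogonality.triangles"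
  proof
    fix B assume B: "B \<in> blocks L"
    then obtain a b c where "B = {a, b, c}" "a \<noteq> b" "b \<noteq> c" "a \<noteq> c"
      using card_block card_3_iff by metis
    moreover from this have "a \<frown> b" "b \<frown> c" "a \<frown> c"
      using B block_adj by blast+
    ultimately show "B \<in> orthogonality.triangles"
      unfolding orthogonality.triangles_def by blast
  qed
  show "orthogonality.triangles \<subseteq> blocks L"
    unfolding orthogonality.triangles_def using orthogonal_triple_block by blast
qed

text \<open>An atom \<open>a\<close> strictly below \<open>x\<close> leaves room for an atom
  \<open>b\<close> below \<open>x\<close> orthogonal to \<open>a\<close>. If \<open>c\<close>
  completes their block, \<open>join_in_triple\<close> puts the complement of \<open>c\<close> below
  \<open>x\<close>, so the complement of \<open>x\<close> lies below the atom
  \<open>c\<close>.\<close>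

lemma carrier_cases:
  assumes x: "x \<in> carrier L"
  obtains "x = \<bottom>" | "x = \<top>" | "x \<in> atoms L" | a where "a \<in> atoms L" "x = ocompl L a"
proof (cases "x = \<bottom> \<or> x \<in> atoms L")
  case False
  then obtain a where a: "a \<in> atoms L" "a \<sqsubseteq> x"
    using atom_below[OF finite_carrier x] by blast
  have ac: "a \<in> carrier L" "a \<noteq> x"
    using a False atom_closed by auto
  obtain z where z: "z \<in> carrier L" "z \<noteq> \<bottom>" "z \<sqsubseteq> x" "z \<sqsubseteq> ocompl L a"
    using nonzero_relative_complement[OF ac(1) x a(2) ac(2)] by blast
  then obtain b where b: "b \<in> atoms L" "b \<sqsubseteq> z"
    using atom_below[OF finite_carrier] by blast
  have bc: "b \<in> carrier L"
    using b atom_closed by blast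
  moreover have "b \<sqsubseteq> x" "b \<sqsubseteq> ocompl L a"
    using le_trans[OF b(2) z(3)] le_trans[OF b(2) z(4)] bc z(1) x ac ocompl_closed by auto
  ultimately have bc: "b \<in> carrier L" "b \<sqsubseteq> x" "b \<sqsubseteq> ocompl L a"
    by auto
  then have "b \<frown> a"
    using a b by (auto simp: atom_adj_def orthogonal_def)
  then obtain c where c: "b \<frown> c" "a \<frown> c"
    using orthogonality.ex1_third by blast
  then have "ocompl L c \<sqsubseteq> x"
    using join_in_triple[of a b c, OF atom_adj_sym] \<open>b \<frown> a\<close> x a bc by auto
  moreover have cc: "c \<in> atoms L" "c \<in> carrier L"
    using c atom_closed by (auto simp: atom_adj_def)
  ultimately have "ocompl L x \<sqsubseteq> c"
    using x ocompl_antimono[of "ocompl L c" x] by (simp add: ocompl_closed ocompl_ocompl)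
  then have "ocompl L x = \<bottom> \<or> ocompl L x = c"
    using cc x ocompl_closed by (auto simp: atoms_def)
  then have "x = \<top> \<or> x = ocompl L c"
    using ocompl_ocompl[OF x] ocompl_bottom by auto
  then show ?thesis
    using that(2) that(4)[OF cc(1)] by (elim disjE)
next
  case True
  then show ?thesis
    using that(1,3) by (elim disjE)
qed

lemma atom_not_bottom: "a \<in> atoms L \<Longrightarrow> a \<noteq> \<bottom>"
  by (simp add: atoms_def)

lemma atom_le_atom_iff: "\<lbrakk>a \<in> atoms L; b \<in> atoms L\<rbrakk> \<Longrightarrow> a \<sqsubseteq> b \<longleftrightarrow> a = b"
  by (auto simp: atoms_def)

text \<open>Every neighbour of \<open>a\<close> is an atom below its complement and would have to
  equal \<open>b\<close>, but \<open>a\<close> has two different neighbours.\<close>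

lemma coatom_not_le_atom:
  assumes a: "a \<in> atoms L" and b: "b \<in> atoms L"
  shows "\<not> ocompl L a \<sqsubseteq> b"
proof
  assume le: "ocompl L a \<sqsubseteq> b"
  obtain c d where cd: "a \<frown> c" "c \<frown> d" "a \<frown> d"
    using ex_block_of_atom[OF a] by blast
  have "x = b" if "a \<frown> x" for x
  proof -
    have "x \<sqsubseteq> ocompl L a" "x \<in> atoms L"
      using atom_adj_sym[OF that] by (auto simp: atom_adj_def orthogonal_def)
    then have "x \<sqsubseteq> b"
      using le_trans[OF _ le] a b atom_closed ocompl_closed by auto
    then show ?thesis
      using atom_le_atom_iff b \<open>x \<in> atoms L\<close> by blast
  qed
  then show False
    using cd atom_adj_irrefl by blast
qed

lemma coatom_le_coatom_iff:
  assumes "a \<in> atoms L" "b \<in> atoms L"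
  shows "ocompl L a \<sqsubseteq> ocompl L b \<longleftrightarrow> a = b"
  using assms ocompl_antimono[of "ocompl L a" "ocompl L b"] atom_le_atom_iff[of b a]
    le_refl[of "ocompl L b"]
  by (auto simp: ocompl_closed ocompl_ocompl atom_closed)

lemma atom_le_coatom_iff:
  "\<lbrakk>a \<in> atoms L; b \<in> atoms L\<rbrakk> \<Longrightarrow> a \<sqsubseteq> ocompl L b \<longleftrightarrow> a \<frown> b"
  by (simp add: atom_adj_def orthogonal_def)

lemma le_bottom_iff: "x \<in> carrier L \<Longrightarrow> x \<sqsubseteq> \<bottom> \<longleftrightarrow> x = \<bottom>"
  using le_antisym[of x \<bottom>] by auto

lemma top_le_iff: "x \<in> carrier L \<Longrightarrow> \<top> \<sqsubseteq> x \<longleftrightarrow> x = \<top>"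
  using le_antisym[of x \<top>] by auto

lemma coatom_not_bottom: "a \<in> atoms L \<Longrightarrow> ocompl L a \<noteq> \<bottom>"
  using coatom_not_le_atom[of a a] atom_closed by auto

lemma coatom_not_top: "a \<in> atoms L \<Longrightarrow> ocompl L a \<noteq> \<top>"
  using ocompl_inject[of a \<bottom>] atom_closed atom_not_bottom by (auto simp: ocompl_bottom)

lemma atom_not_top: "a \<in> atoms L \<Longrightarrow> a \<noteq> \<top>"
  using coatom_not_bottom ocompl_top by auto

end

section \<open>Comparison with the even subsets of a six-element set\<close>

lemma duad_subset_six: "X \<in> duads \<Longrightarrow> X \<subseteq> {1..6}"
  by (simp add: duads_def)

lemma card_duad: "X \<in> duads \<Longrightarrow> card X = 2"
  by (simp add: duads_def)

lemma finite_duad: "X \<in> duads \<Longrightarrow> finite X"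
  using finite_subset by (auto simp: duads_def)

lemma card_duad_complement: "X \<in> duads \<Longrightarrow> card ({1..6} - X) = 4"
  using finite_duad[of X] duad_subset_six[of X] card_duad[of X] by (simp add: card_Diff_subset)

lemma duad_subset_iff: "\<lbrakk>X \<in> duads; Y \<in> duads\<rbrakk> \<Longrightarrow> X \<subseteq> Y \<longleftrightarrow> X = Y"
  using card_subset_eq[of Y X] finite_duad[of Y] card_duad by auto

lemma duad_complement_subset_iff:
  "\<lbrakk>X \<in> duads; Y \<in> duads\<rbrakk> \<Longrightarrow> {1..6} - X \<subseteq> {1..6} - Y \<longleftrightarrow> X = Y"
  using duad_subset_iff[of Y X] duad_subset_six[of X] duad_subset_six[of Y] by blast

lemma duad_complement_not_subset_duad:
  "\<lbrakk>X \<in> duads; Y \<in> duads\<rbrakk> \<Longrightarrow> \<not> {1..6} - X \<subseteq> Y"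
  using card_mono[of Y "{1..6} - X"] finite_duad[of Y] card_duad[of Y] card_duad_complement[of X]
  by auto

text \<open>The four-element subsets are the complements of duads; this matches
  \<open>carrier_cases\<close> kind by kind.\<close>

lemma carrier_L32:
  "carrier L32 = {{}, {1..6}} \<union> duads \<union> (\<lambda>X. {1..6} - X) ` duads"
proof
  show "carrier L32 \<subseteq> {{}, {1..6}} \<union> duads \<union> (\<lambda>X. {1..6} - X) ` duads"
  proof
    fix X assume "X \<in> carrier L32"
    then have X: "X \<subseteq> {1..6}" "even (card X)"
      by (auto simp: L32_def inclusion_logic_def cong_def even_iff_mod_2_eq_zero)
    then have fin: "finite X" and "card X \<le> 6"
      using finite_subset card_mono[OF _ X(1)] by auto
    have "card X = 0 \<or> card X = 2 \<or> card X = 4 \<or> card X = 6"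
      using X(2) \<open>card X \<le> 6\<close> by presburger
    then consider "card X = 0" | "card X = 2" | "card X = 4" | "card X = 6"
      by (elim disjE)
    then show "X \<in> {{}, {1..6}} \<union> duads \<union> (\<lambda>X. {1..6} - X) ` duads"
    proof cases
      case 3
      then have "{1..6} - X \<in> duads"
        using X fin by (simp add: duads_def card_Diff_subset)
      moreover have "X = {1..6} - ({1..6} - X)"
        using X(1) by blast
      ultimately show ?thesis
        by blast
    qed (use X fin card_subset_eq[of "{1..6}" X] in \<open>auto simp: duads_def\<close>)
  qed
  show "{{}, {1..6}} \<union> duads \<union> (\<lambda>X. {1..6} - X) ` duads \<subseteq> carrier L32"
    using card_duad card_duad_complement duad_subset_six
    by (auto simp: L32_def inclusion_logic_def cong_def)
qed

lemma (in three_block_omp) isomorphic_L32: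
  assumes hom: "homogeneous 3 3 L" and card: "card (atoms L) = 15"
  shows "omp_isomorphic L L32"
proof -
  have deg: "\<forall>a\<in>atoms L. card {b. a \<frown> b} = 6"
    using hom orthogonality.degree_eq by (simp add: homogeneous_def blocks_eq_triangles)
  obtain F where F: "bij_betw F duads (atoms L)"
    and F_adj': "\<forall>X\<in>duads. \<forall>Y\<in>duads. F X \<frown> F Y \<longleftrightarrow> X \<inter> Y = {}"
    using orthogonality.duad_labelling[OF card deg] by (elim exE conjE)
  note F_adj = F_adj'[THEN bspec, THEN bspec]
  define g where "g = inv_into duads F"
  have g_duad: "g a \<in> duads" if "a \<in> atoms L" for a
    using F that by (metis bij_betw_def g_def inv_into_into)
  have Fg: "F (g a) = a" if "a \<in> atoms L" for a
    using F that by (metis bij_betw_inv_into_right g_def)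
  have gF: "g (F X) = X" if "X \<in> duads" for X
    using F that by (metis bij_betw_inv_into_left g_def)
  have F_atom: "F X \<in> atoms L" if "X \<in> duads" for X
    using F that by (metis bij_betwE)
  have g_eq_iff: "g a = g b \<longleftrightarrow> a = b" if "a \<in> atoms L" "b \<in> atoms L" for a b
    using Fg that by metis
  have g_adj: "a \<frown> b \<longleftrightarrow> g a \<inter> g b = {}" if "a \<in> atoms L" "b \<in> atoms L" for a b
    using F_adj[of "g a" "g b"] g_duad Fg that by simp
  define f where "f x = (if x = \<bottom> then {} else if x = \<top> then {1..6} else if x \<in> atoms L then g x
    else {1..6} - g (ocompl L x))" for x
  have bt: "\<bottom> \<noteq> \<top>"
  proof -
    obtain a where "a \<in> atoms L"
      using card by (metis card.empty equals0I zero_neq_numeral)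
    then show ?thesis
      using atom_closed[of a] atom_not_bottom le_bottom_iff by fastforce
  qed
  have coatom: "ocompl L a \<notin> atoms L" if "a \<in> atoms L" for a
    using coatom_not_le_atom[OF that] le_refl atom_closed by blast
  have f_bottom: "f \<bottom> = {}" and f_top: "f \<top> = {1..6}"
    using bt by (auto simp: f_def)
  have f_atom: "f a = g a" and f_coatom: "f (ocompl L a) = {1..6} - g a" if "a \<in> atoms L" for a
    using that coatom atom_not_bottom atom_not_top coatom_not_bottom coatom_not_top
    by (auto simp: f_def ocompl_ocompl atom_closed)
  note f_simps = f_bottom f_top f_atom f_coatom
  \<comment> \<open>Both orders are tabulated on the four kinds of elements. The entry that carries
    information is atom below coatom: adjacency on one side, disjointness of duads on the
    other.\<close>
  have f_le: "x \<sqsubseteq> y \<longleftrightarrow> f x \<subseteq> f y" if x: "x \<in> carrier L" and y: "y \<in> carrier L" for x y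
  proof -
    have g0: "g a \<noteq> {}" "\<not> {1..6} \<subseteq> g a" "g a \<subseteq> {1..6}" "\<not> {1..6} - g a \<subseteq> {}" if "a \<in> atoms L" for a
      using card_duad[OF g_duad[OF that]] duad_subset_six[OF g_duad[OF that]]
        card_duad_complement[OF g_duad[OF that]] by auto
    have g1: "\<not> {1..6} \<subseteq> {1..6} - g a" if "a \<in> atoms L" for a
      using g0(1,3)[OF that] by blast
    have g2: "g a \<subseteq> {1..6} - g b \<longleftrightarrow> g a \<inter> g b = {}" if "a \<in> atoms L" "b \<in> atoms L" for a b
      using g0(3)[OF that(1)] by blast
    note simps = f_simps g0 g1 g2 atom_le_atom_iff coatom_le_coatom_iff atom_le_coatom_iff
      coatom_not_le_atom duad_subset_iff duad_complement_subset_iff duad_complement_not_subset_duad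
      g_duad g_eq_iff g_adj top_le_iff le_bottom_iff atom_closed ocompl_closed atom_not_bottom
      atom_not_top coatom_not_bottom coatom_not_top bt bt[symmetric]
    show ?thesis
      by (rule carrier_cases[OF x]; rule carrier_cases[OF y]; hypsubst?; simp add: simps del: One_nat_def)
  qed
  have f_mem: "f x \<in> carrier L32" if "x \<in> carrier L" for x
    by (rule carrier_cases[OF that]) (auto simp: f_simps carrier_L32 g_duad)
  have f_ocompl: "f (ocompl L x) = {1..6} - f x" if "x \<in> carrier L" for x
    by (rule carrier_cases[OF that])
      (auto simp: f_simps ocompl_bottom ocompl_top ocompl_ocompl atom_closed
        dest: duad_subset_six[OF g_duad, THEN subsetD])
  have "inj_on f (carrier L)"
    using f_le le_antisym by (intro inj_onI) auto
  moreover have "X \<in> f ` carrier L" if "X \<in> carrier L32" for X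
  proof -
    have "X = {} \<or> X = {1..6} \<or> X \<in> duads \<or> (\<exists>Y\<in>duads. X = {1..6} - Y)"
      using that unfolding carrier_L32 by blast
    then show ?thesis
    proof (elim disjE bexE)
      assume "X = {}"
      then show ?thesis using f_bottom by (intro image_eqI[of _ _ \<bottom>]) auto
    next
      assume "X = {1..6}"
      then show ?thesis using f_top by (intro image_eqI[of _ _ \<top>]) auto
    next
      assume "X \<in> duads"
      then show ?thesis
        using F_atom by (intro image_eqI[of _ _ "F X"]) (auto simp: f_simps gF atom_closed)
    next
      fix Y assume "Y \<in> duads" "X = {1..6} - Y"
      then show ?thesis
        using F_atom
        by (intro image_eqI[of _ _ "ocompl L (F Y)"]) (auto simp: f_simps gF atom_closed ocompl_closed)
    qed
  qed
  ultimately have "bij_betw f (carrier L) (carrier L32)"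
    using f_mem by (auto simp: bij_betw_def)
  moreover have "weak_partial_order L32"
    by unfold_locales (auto simp: L32_def inclusion_logic_def)
  then have "order_emb L L32 f"
    using f_le weak_partial_order_axioms
    by (simp add: order_emb_def L32_def inclusion_logic_def)
  moreover have "\<forall>x\<in>carrier L. f (ocompl L x) = ocompl L32 (f x)"
    using f_ocompl by (simp add: L32_def inclusion_logic_def)
  ultimately show ?thesis
    unfolding omp_isomorphic_def by blast
qed

section \<open>The orthomodular poset of a graph\<close>

context orthomodular_poset
begin

lemma orthogonal_join_closed:
  "\<lbrakk>x \<in> carrier L; y \<in> carrier L; orthogonal L x y\<rbrakk> \<Longrightarrow> x \<squnion> y \<in> carrier L"
  using orthogonal_lub[of x y] by (auto simp: least_def)

lemma state_ocompl:
  assumes "s \<in> states L" "x \<in> carrier L"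
  shows "s (ocompl L x) = 1 - s x"
proof -
  have "orthogonal L x (ocompl L x)"
    using assms(2) by (simp add: orthogonal_def ocompl_ocompl)
  then have "s (x \<squnion> ocompl L x) = s x + s (ocompl L x)"
    using assms ocompl_closed by (simp add: states_def)
  then show ?thesis
    using assms join_eqI[OF ocompl_join[OF assms(2)]] by (simp add: states_def)
qed

text \<open>If the sets of \<open>x\<close> and \<open>y\<close> are disjoint, every two-valued
  state is at most as large on \<open>x\<close> as on the complement of \<open>y\<close>. Fullness
  turns this into orthogonality, and additivity then makes the union the set of the join.\<close>

lemma total_representation_concrete:
  assumes full: "full_states L (two_valued_states L)"
  shows "concrete_logic (two_valued_states L) (total_representation L)"
proof -
  let ?S = "two_valued_states L"
  define T where "T x = {\<mu> \<in> ?S. \<mu> x = 1}" for x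
  have E: "total_representation L = T ` carrier L"
    by (simp add: total_representation_def T_def)
  have two: "s x = 0 \<or> s x = 1" if "s \<in> ?S" "x \<in> carrier L" for s x
    using that by (auto simp: two_valued_states_def)
  have top: "T \<top> = ?S"
    by (auto simp: T_def two_valued_states_def states_def)
  have compl: "?S - T x = T (ocompl L x)" if x: "x \<in> carrier L" for x
  proof -
    have "s x \<noteq> 1 \<longleftrightarrow> s (ocompl L x) = 1" if "s \<in> ?S" for s
      using two[OF that x] state_ocompl[OF _ x, of s] that by (auto simp: two_valued_states_def)
    then show ?thesis
      by (auto simp: T_def)
  qed
  have union: "T x \<union> T y \<in> T ` carrier L"
    if xy: "x \<in> carrier L" "y \<in> carrier L" "T x \<inter> T y = {}" for x y
  proof -
    have "s x \<le> s (ocompl L y)" if s: "s \<in> ?S" for s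
    proof -
      have "\<not> (s x = 1 \<and> s y = 1)"
        using xy(3) s by (auto simp: T_def)
      moreover have "s (ocompl L y) = 1 - s y"
        using s state_ocompl[OF _ xy(2)] by (auto simp: two_valued_states_def)
      ultimately show ?thesis
        using two[OF s xy(1)] two[OF s xy(2)] by auto
    qed
    then have orth: "orthogonal L x y"
      using full xy ocompl_closed by (auto simp: full_states_def orthogonal_def)
    have "s (x \<squnion> y) = s x + s y" if "s \<in> ?S" for s
      using that xy orth by (auto simp: two_valued_states_def states_def)
    then have "T (x \<squnion> y) = T x \<union> T y"
      using two[OF _ xy(1)] two[OF _ xy(2)] xy(3) unfolding T_def by fastforce
    then show ?thesis
      using orthogonal_join_closed[OF xy(1,2) orth] by (metis imageI)
  qed
  show ?thesis
    unfolding concrete_logic_def E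
    using top compl union ocompl_closed by (auto simp: T_def)
qed

end

section \<open>The orthomodular poset built from a graph\<close>

definition atom_code :: "nat \<Rightarrow> nat" where "atom_code p = 2 * p + 2"

definition coatom_code :: "nat \<Rightarrow> nat" where "coatom_code p = 2 * p + 3"

lemma code_inject [simp]:
  "atom_code p = atom_code q \<longleftrightarrow> p = q" "coatom_code p = coatom_code q \<longleftrightarrow> p = q"
  by (auto simp: atom_code_def coatom_code_def)

lemma code_distinct [simp]:
  "atom_code p \<noteq> coatom_code q" "coatom_code q \<noteq> atom_code p"
  "atom_code p \<noteq> 0" "0 \<noteq> atom_code p" "atom_code p \<noteq> Suc 0" "Suc 0 \<noteq> atom_code p"
  "coatom_code p \<noteq> 0" "0 \<noteq> coatom_code p" "coatom_code p \<noteq> Suc 0" "Suc 0 \<noteq> coatom_code p"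
  unfolding atom_code_def coatom_code_def by presburger+

lemma code_pos [simp]: "0 < atom_code p" "0 < coatom_code p"
  by (simp_all add: atom_code_def coatom_code_def)

text \<open>
  The codes \<open>0\<close> and \<open>1\<close> are bottom and top; complementation swaps \<open>2k\<close> and \<open>2k + 1\<close>.
\<close>
definition graph_logic :: "nat set \<Rightarrow> (nat \<Rightarrow> nat \<Rightarrow> bool) \<Rightarrow> nat orthoposet" where
  "graph_logic P adj = \<lparr>carrier = {0, 1} \<union> atom_code ` P \<union> coatom_code ` P, eq = (=),
     le = (\<lambda>x y. x = 0 \<or> y = 1 \<or> x = y \<or> (\<exists>p q. x = atom_code p \<and> y = coatom_code q \<and> adj p q)),
     ocompl = (\<lambda>x. if even x then x + 1 else x - 1)\<rparr>"

text \<open>The two conditions make the atoms of the logic exactly the points: without points the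
  top would be an atom, and the complement of an isolated point would be one too.\<close>

locale point_logic = unique_triangle_graph P adj
  for P :: "nat set" and adj :: "nat \<Rightarrow> nat \<Rightarrow> bool"  (infix \<open>\<frown>\<close> 50) +
  assumes points_nonempty: "P \<noteq> {}"
    and ex_nbr: "p \<in> P \<Longrightarrow> \<exists>q. p \<frown> q"
begin

definition G :: "nat orthoposet" where "G = graph_logic P (\<frown>)"

lemma eq_G [simp]: "eq G = (=)"
  by (simp add: G_def graph_logic_def)

lemma ocompl_G [simp]:
  "ocompl G 0 = Suc 0" "ocompl G (Suc 0) = 0"
  "ocompl G (atom_code p) = coatom_code p" "ocompl G (coatom_code p) = atom_code p"
  by (auto simp: G_def graph_logic_def atom_code_def coatom_code_def)

lemma carrier_G: "carrier G = {0, Suc 0} \<union> atom_code ` P \<union> coatom_code ` P"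
  by (simp add: G_def graph_logic_def)

lemma in_carrier_G [simp]:
  "0 \<in> carrier G" "Suc 0 \<in> carrier G"
  "atom_code p \<in> carrier G \<longleftrightarrow> p \<in> P" "coatom_code p \<in> carrier G \<longleftrightarrow> p \<in> P"
  by (auto simp: carrier_G)

lemma G_elem_cases:
  assumes "x \<in> carrier G"
  shows "x = 0 \<or> x = Suc 0 \<or> (\<exists>p\<in>P. x = atom_code p) \<or> (\<exists>p\<in>P. x = coatom_code p)"
  using assms by (auto simp: carrier_G)

lemma le_G [simp]:
  "0 \<sqsubseteq>\<^bsub>G\<^esub> x" "x \<sqsubseteq>\<^bsub>G\<^esub> Suc 0" "x \<sqsubseteq>\<^bsub>G\<^esub> x"
  "\<not> Suc 0 \<sqsubseteq>\<^bsub>G\<^esub> 0" "\<not> Suc 0 \<sqsubseteq>\<^bsub>G\<^esub> atom_code p" "\<not> Suc 0 \<sqsubseteq>\<^bsub>G\<^esub> coatom_code p"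
  "\<not> atom_code p \<sqsubseteq>\<^bsub>G\<^esub> 0" "\<not> coatom_code p \<sqsubseteq>\<^bsub>G\<^esub> 0"
  "atom_code p \<sqsubseteq>\<^bsub>G\<^esub> atom_code q \<longleftrightarrow> p = q"
  "atom_code p \<sqsubseteq>\<^bsub>G\<^esub> coatom_code q \<longleftrightarrow> p \<frown> q"
  "\<not> coatom_code p \<sqsubseteq>\<^bsub>G\<^esub> atom_code q"
  "coatom_code p \<sqsubseteq>\<^bsub>G\<^esub> coatom_code q \<longleftrightarrow> p = q"
  by (auto simp: G_def graph_logic_def)

lemma ocompl_G_closed: "x \<in> carrier G \<Longrightarrow> ocompl G x \<in> carrier G"
  using G_elem_cases[of x] by auto

lemma ocompl_ocompl_G: "x \<in> carrier G \<Longrightarrow> ocompl G (ocompl G x) = x"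
  using G_elem_cases[of x] by auto

text \<open>Turns claims about suprema and infima into finitely many comparisons between kinds of
  elements, which \<open>le_G\<close> decides.\<close>

lemma ball_carrier_G:
  "(\<forall>x\<in>carrier G. Q x) \<longleftrightarrow>
    Q 0 \<and> Q (Suc 0) \<and> (\<forall>p\<in>P. Q (atom_code p)) \<and> (\<forall>p\<in>P. Q (coatom_code p))"
  by (auto simp: carrier_G)

sublocale G: partial_order G
proof unfold_locales
  fix x y z
  show "x .=\<^bsub>G\<^esub> y" if "x \<sqsubseteq>\<^bsub>G\<^esub> y" "y \<sqsubseteq>\<^bsub>G\<^esub> x" "x \<in> carrier G" "y \<in> carrier G"
    using that G_elem_cases[of x] G_elem_cases[of y] by auto
  show "x \<sqsubseteq>\<^bsub>G\<^esub> z"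
    if "x \<sqsubseteq>\<^bsub>G\<^esub> y" "y \<sqsubseteq>\<^bsub>G\<^esub> z" "x \<in> carrier G" "y \<in> carrier G" "z \<in> carrier G"
    using that G_elem_cases[of x] G_elem_cases[of y] G_elem_cases[of z] by auto
qed auto

lemma is_lub_G_iff:
  assumes "x \<in> carrier G" "y \<in> carrier G"
  shows "is_lub G z {x, y} \<longleftrightarrow> z \<in> carrier G \<and> x \<sqsubseteq>\<^bsub>G\<^esub> z \<and> y \<sqsubseteq>\<^bsub>G\<^esub> z \<and>
    (\<forall>u\<in>carrier G. x \<sqsubseteq>\<^bsub>G\<^esub> u \<and> y \<sqsubseteq>\<^bsub>G\<^esub> u \<longrightarrow> z \<sqsubseteq>\<^bsub>G\<^esub> u)"
  using assms by (auto simp: least_def Upper_def)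

lemma is_glb_G_iff:
  assumes "x \<in> carrier G" "y \<in> carrier G"
  shows "is_glb G z {x, y} \<longleftrightarrow> z \<in> carrier G \<and> z \<sqsubseteq>\<^bsub>G\<^esub> x \<and> z \<sqsubseteq>\<^bsub>G\<^esub> y \<and>
    (\<forall>u\<in>carrier G. u \<sqsubseteq>\<^bsub>G\<^esub> x \<and> u \<sqsubseteq>\<^bsub>G\<^esub> y \<longrightarrow> u \<sqsubseteq>\<^bsub>G\<^esub> z)"
  using assms by (auto simp: greatest_def Lower_def)

lemma bottom_G: "\<bottom>\<^bsub>G\<^esub> = 0"
proof -
  have "least G 0 (carrier G)"
    by (auto simp: least_def)
  then show ?thesis
    unfolding bottom_def by (metis (mono_tags, lifting) G.least_unique someI)
qed

lemma top_G: "\<top>\<^bsub>G\<^esub> = Suc 0"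
proof -
  have "greatest G (Suc 0) (carrier G)"
    by (auto simp: greatest_def)
  then show ?thesis
    unfolding top_def by (metis (mono_tags, lifting) G.greatest_unique someI)
qed

lemma orthogonal_G_cases:
  assumes "x \<in> carrier G" "y \<in> carrier G" "orthogonal G x y"
  shows "x = 0 \<or> y = 0 \<or> y = ocompl G x \<or> (\<exists>p q. x = atom_code p \<and> y = atom_code q \<and> p \<frown> q)"
  using assms G_elem_cases[of x] G_elem_cases[of y] by (auto simp: orthogonal_def)

lemma lub_complement: "x \<in> carrier G \<Longrightarrow> is_lub G (Suc 0) {x, ocompl G x}"
  using G_elem_cases[of x]
  by (auto simp: is_lub_G_iff ocompl_G_closed ball_carrier_G adj_irrefl)

lemma glb_complement: "x \<in> carrier G \<Longrightarrow> is_glb G 0 {x, ocompl G x}"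
  using G_elem_cases[of x]
  by (auto simp: is_glb_G_iff ocompl_G_closed ball_carrier_G adj_irrefl)

lemma lub_bottom: "x \<in> carrier G \<Longrightarrow> is_lub G x {x, 0}"
  by (simp add: is_lub_G_iff)

text \<open>Besides the top, the upper bounds of two adjacent atoms are the coatoms of their common
  neighbours, and there is just one.\<close>

lemma lub_adjacent:
  assumes pq: "p \<frown> q"
  shows "is_lub G (coatom_code (third p q)) {atom_code p, atom_code q}"
proof -
  have "p \<in> P" "q \<in> P" "p \<noteq> q" "third p q \<in> P" "p \<frown> third p q" "q \<frown> third p q"
    using pq third_adj[OF pq] adj_point adj_point2 adj_neq by auto
  moreover have "p \<frown> r \<and> q \<frown> r \<longleftrightarrow> r = third p q" for r
    using third_unique[OF pq, of r] third_adj[OF pq] by auto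
  ultimately show ?thesis
    by (simp add: is_lub_G_iff ball_carrier_G)
qed

lemma glb_adjacent:
  assumes pq: "p \<frown> q"
  shows "is_glb G (atom_code (third p q)) {coatom_code q, coatom_code p}"
proof -
  have "p \<in> P" "q \<in> P" "p \<noteq> q" "third p q \<in> P" "third p q \<frown> p" "third p q \<frown> q"
    using pq third_adj[OF pq] adj_point adj_point2 adj_neq adj_sym by auto
  moreover have "r \<frown> q \<and> r \<frown> p \<longleftrightarrow> r = third p q" for r
    using third_unique[OF pq, of r] third_adj[OF pq] adj_sym by blast
  ultimately show ?thesis
    by (simp add: is_glb_G_iff ball_carrier_G)
qed

lemma is_glb_G_top: "x \<in> carrier G \<Longrightarrow> is_glb G x {x, Suc 0}"
  by (simp add: is_glb_G_iff)

sublocale G: orthomodular_poset G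
proof unfold_locales
  show "\<exists>x. least G x (carrier G)"
    by (rule exI[of _ 0]) (auto simp: least_def)
  show "\<exists>x. greatest G x (carrier G)"
    by (rule exI[of _ "Suc 0"]) (auto simp: greatest_def)
  fix x y assume x: "x \<in> carrier G"
  show "ocompl G x \<in> carrier G" "ocompl G (ocompl G x) = x"
    using x by (simp_all add: ocompl_G_closed ocompl_ocompl_G)
  show "is_glb G \<bottom>\<^bsub>G\<^esub> {x, ocompl G x}" "is_lub G \<top>\<^bsub>G\<^esub> {x, ocompl G x}"
    using x by (simp_all add: bottom_G top_G glb_complement lub_complement)
  assume y: "y \<in> carrier G"
  show "ocompl G y \<sqsubseteq>\<^bsub>G\<^esub> ocompl G x" if "x \<sqsubseteq>\<^bsub>G\<^esub> y"
    using that x y G_elem_cases[of x] G_elem_cases[of y] by (auto intro: adj_sym)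
  show "\<exists>z. is_lub G z {x, y}" if "orthogonal G x y"
    using orthogonal_G_cases[OF x y that] x y lub_complement[of x] lub_bottom[of x] lub_bottom[of y]
      lub_adjacent by (auto simp: insert_commute)
  show "y = x \<squnion>\<^bsub>G\<^esub> (y \<sqinter>\<^bsub>G\<^esub> ocompl G x)" if "x \<sqsubseteq>\<^bsub>G\<^esub> y"
  proof -
    have "x = 0 \<or> y = Suc 0 \<or> x = y \<or>
        (\<exists>p q. x = atom_code p \<and> y = coatom_code q \<and> p \<frown> q)"
      using that x y G_elem_cases[of x] G_elem_cases[of y] by auto
    then show ?thesis
    proof (elim disjE exE conjE)
      assume "x = 0"
      then show ?thesis
        using y lub_bottom[OF y] G.meet_eqI[OF is_glb_G_top[OF y]]
        by (simp add: G.join_eqI insert_commute)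
    next
      assume 2: "y = Suc 0"
      have "is_glb G (ocompl G x) {Suc 0, ocompl G x}"
        using is_glb_G_top[OF ocompl_G_closed[OF x]] by (simp add: insert_commute)
      then show ?thesis
        using 2 G.join_eqI[OF lub_complement[OF x]] by (simp add: G.meet_eqI)
    next
      assume "x = y"
      then show ?thesis
        using G.meet_eqI[OF glb_complement[OF x]] G.join_eqI[OF lub_bottom[OF x]] by simp
    next
      fix p q assume 4: "x = atom_code p" "y = coatom_code q" "p \<frown> q"
      \<comment> \<open>The meet of \<open>y\<close> with the complement of \<open>x\<close> is the
        atom of \<open>third p q\<close>. Joining it with \<open>x\<close> leads to the coatom of
        \<open>third p (third p q)\<close>, which is \<open>y\<close>.\<close>
      have "third p (third p q) = q"
        using 4(3) third_adj[of p q] adj_sym by (auto intro!: third_unique)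
      then show ?thesis
        using 4 G.meet_eqI[OF glb_adjacent[OF 4(3)]] third_adj[OF 4(3)]
          G.join_eqI[OF lub_adjacent[of p "third p q"]] by simp
    qed
  qed
qed

end

section \<open>Atoms, blocks and homogeneity of the graph logic\<close>

context point_logic
begin

lemma atoms_G: "atoms G = atom_code ` P"
proof
  show "atom_code ` P \<subseteq> atoms G"
    by (auto simp: atoms_def bottom_G ball_carrier_G)
  show "atoms G \<subseteq> atom_code ` P"
  proof
    fix a assume a: "a \<in> atoms G"
    then have "a \<noteq> 0" "a \<in> carrier G"
      and le: "\<forall>x\<in>carrier G. x \<sqsubseteq>\<^bsub>G\<^esub> a \<longrightarrow> x = 0 \<or> x = a"
      by (auto simp: atoms_def bottom_G)
    obtain p where "p \<in> P"
      using points_nonempty by blast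
    then have "a \<noteq> Suc 0"
      using le[THEN bspec, of "atom_code p"] by auto
    moreover have "a \<noteq> coatom_code q" if "q \<in> P" for q
    proof -
      obtain r where "q \<frown> r"
        using ex_nbr \<open>q \<in> P\<close> by blast
      then show ?thesis
        using le[THEN bspec, of "atom_code r"] adj_point2 adj_sym by auto
    qed
    ultimately show "a \<in> atom_code ` P"
      using G_elem_cases[OF \<open>a \<in> carrier G\<close>] \<open>a \<noteq> 0\<close> by auto
  qed
qed

lemma finite_carrier_G: "finite (carrier G)"
  using finite_points by (simp add: carrier_G)

lemma orthogonal_atoms_G: "orthogonal G (atom_code p) (atom_code q) \<longleftrightarrow> p \<frown> q"
  by (simp add: orthogonal_def)

lemma orthogonal_atom_set_G:
  "orthogonal_atom_set G (atom_code ` C) \<longleftrightarrow> C \<subseteq> P \<and> pairwise (\<frown>) C"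
  by (auto simp: orthogonal_atom_set_def atoms_G pairwise_def orthogonal_atoms_G)

text \<open>Blocks are the codes of maximal cliques. A clique containing an edge lies in the
  triangle of that edge, and a clique without an edge extends to one.\<close>

sublocale G: three_block_omp G
proof unfold_locales
  show "finite (carrier G)"
    by (rule finite_carrier_G)
  fix B assume B: "B \<in> blocks G"
  then have "B \<subseteq> atom_code ` P"
    by (simp add: blocks_def orthogonal_atom_set_def atoms_G)
  then obtain C where C: "B = atom_code ` C"
    by (metis subset_imageE)
  have clique: "C \<subseteq> P" "pairwise (\<frown>) C"
    using B unfolding C blocks_def by (simp_all add: orthogonal_atom_set_G)
  have maximal: "D = C" if "D \<subseteq> P" "pairwise (\<frown>) D" "C \<subseteq> D" for D
  proof -
    have "orthogonal_atom_set G (atom_code ` D)" "atom_code ` C \<subseteq> atom_code ` D"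
      using that by (auto simp: orthogonal_atom_set_G)
    then have "atom_code ` D = atom_code ` C"
      using B unfolding C blocks_def by blast
    then show ?thesis
      by (simp add: inj_image_eq_iff inj_def)
  qed
  have "\<exists>p q. p \<frown> q \<and> p \<in> C \<and> q \<in> C"
  proof (cases "\<exists>p\<in>C. \<exists>q\<in>C. p \<noteq> q")
    case True
    then show ?thesis
      using clique(2) unfolding pairwise_def by blast
  next
    case False
    \<comment> \<open>This covers the empty clique as well, with any point as
      \<open>x\<close>.\<close>
    obtain x where "x \<in> P" "C \<subseteq> {x}"
      using False clique(1) points_nonempty by blast
    obtain y where "x \<frown> y"
      using ex_nbr \<open>x \<in> P\<close> by blast
    then have "{x, y} = C"
      using \<open>C \<subseteq> {x}\<close> adj_sym adj_point adj_point2
      by (intro maximal) (auto simp: pairwise_def)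
    then show ?thesis
      using \<open>x \<frown> y\<close> by blast
  qed
  then obtain p q where pq: "p \<frown> q" "p \<in> C" "q \<in> C"
    by blast
  have "C \<subseteq> {p, q, third p q}"
  proof
    fix r assume r: "r \<in> C"
    have "r = third p q" if "r \<noteq> p" "r \<noteq> q"
      using third_unique[OF pq(1), of r] clique(2) pq(2,3) r that by (auto simp: pairwise_def)
    then show "r \<in> {p, q, third p q}"
      by blast
  qed
  then have "{p, q, third p q} = C"
    using third_adj[OF pq(1)] pq(1) adj_sym adj_point adj_point2
    by (intro maximal) (auto simp: pairwise_def)
  then have "card C = 3"
    using card_triangle[OF edge_in_triangle[OF pq(1)]] by simp
  then show "card B = 3"
    by (simp add: C card_image inj_on_def)
qed

lemma G_homogeneous:
  assumes "\<forall>p\<in>P. card {q. p \<frown> q} = 6"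
  shows "homogeneous 3 3 G"
proof -
  have "card {B \<in> blocks G. a \<in> B} = 3" if a: "a \<in> atoms G" for a
  proof -
    obtain p where p: "p \<in> P" "a = atom_code p"
      using a by (auto simp: atoms_G)
    have "{b. G.atom_adj a b} = atom_code ` {q. p \<frown> q}"
      using p adj_point2 by (auto simp: G.atom_adj_def atoms_G orthogonal_atoms_G)
    then have "card {b. G.atom_adj a b} = 6"
      using assms p by (simp add: card_image inj_on_def)
    then show ?thesis
      using G.orthogonality.degree_eq[of a] by (simp add: G.blocks_eq_triangles)
  qed
  then show ?thesis
    using G.card_block by (simp add: homogeneous_def)
qed

lemma card_atoms_G: "card (atoms G) = card P"
  by (simp add: atoms_G card_image inj_on_def)

section \<open>States\<close>

text \<open>These are the restrictions of states to the atoms; the upper bound 1 comes out in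
  \<open>weight_le_1\<close>.\<close>

definition weight :: "(nat \<Rightarrow> real) \<Rightarrow> bool" where
  "weight w \<longleftrightarrow> (\<forall>p\<in>P. 0 \<le> w p) \<and> (\<forall>p q. p \<frown> q \<longrightarrow> w p + w q + w (third p q) = 1)"

text \<open>Both codes of \<open>p\<close> give \<open>p + 1\<close> on division by 2, so
  \<open>x div 2 - 1\<close> recovers the point, and parity separates atoms from coatoms.\<close>

definition state_of :: "(nat \<Rightarrow> real) \<Rightarrow> nat \<Rightarrow> real" where
  "state_of w = (\<lambda>x\<in>carrier G. if x = 0 then 0 else if x = 1 then 1
     else if even x then w (x div 2 - 1) else 1 - w (x div 2 - 1))"

lemma state_of_simps [simp]:
  "state_of w 0 = 0" "state_of w (Suc 0) = 1"
  "p \<in> P \<Longrightarrow> state_of w (atom_code p) = w p"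
  "p \<in> P \<Longrightarrow> state_of w (coatom_code p) = 1 - w p"
  by (simp_all add: state_of_def) (auto simp: atom_code_def coatom_code_def)

lemma state_sum:
  assumes s: "s \<in> states G" and pq: "p \<frown> q"
  shows "s (atom_code p) + s (atom_code q) + s (atom_code (third p q)) = 1"
proof -
  have "s (atom_code p \<squnion>\<^bsub>G\<^esub> atom_code q) = s (atom_code p) + s (atom_code q)"
    using s pq adj_point[OF pq] adj_point2[OF pq] by (simp add: states_def orthogonal_atoms_G)
  then have "s (coatom_code (third p q)) = s (atom_code p) + s (atom_code q)"
    by (simp add: G.join_eqI[OF lub_adjacent[OF pq]])
  moreover have "s (coatom_code (third p q)) = 1 - s (atom_code (third p q))"
    using G.state_ocompl[OF s, of "atom_code (third p q)"] third_adj[OF pq] adj_point2 by auto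
  ultimately show ?thesis
    by simp
qed

lemma state_weight: "s \<in> states G \<Longrightarrow> weight (\<lambda>p. s (atom_code p))"
  using state_sum by (auto simp: weight_def) (auto simp: states_def PiE_def Pi_def)

lemma state_of_state:
  assumes s: "s \<in> states G"
  shows "state_of (\<lambda>p. s (atom_code p)) = s"
proof (rule extensionalityI[of _ "carrier G"])
  have top: "s (Suc 0) = 1"
    using s by (simp add: states_def top_G)
  moreover have "s 0 = 0"
    using G.state_ocompl[OF s, of "Suc 0"] top by simp
  moreover have "s (coatom_code p) = 1 - s (atom_code p)" if "p \<in> P" for p
    using G.state_ocompl[OF s, of "atom_code p"] that by simp
  ultimately show "state_of (\<lambda>p. s (atom_code p)) x = s x" if "x \<in> carrier G" for x
    using G_elem_cases[OF that] by auto
qed (use s in \<open>auto simp: state_of_def states_def PiE_def\<close>)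

lemma weight_le_1:
  assumes w: "weight w" and p: "p \<in> P"
  shows "w p \<le> 1"
proof -
  obtain q where q: "p \<frown> q"
    using ex_nbr p by blast
  then have "0 \<le> w q" "0 \<le> w (third p q)" "w p + w q + w (third p q) = 1"
    using w third_adj[OF q] adj_point2 by (auto simp: weight_def)
  then show ?thesis
    by linarith
qed

lemma state_of_weight:
  assumes w: "weight w"
  shows "state_of w \<in> states G"
proof -
  have "state_of w x \<in> {0..1}" if "x \<in> carrier G" for x
    using G_elem_cases[OF that] w weight_le_1[OF w] by (auto simp: weight_def)
  moreover have "state_of w \<in> extensional (carrier G)"
    by (simp add: state_of_def)
  moreover have "state_of w (x \<squnion>\<^bsub>G\<^esub> y) = state_of w x + state_of w y"
    if x: "x \<in> carrier G" and y: "y \<in> carrier G" and orth: "orthogonal G x y" for x y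
    using orthogonal_G_cases[OF x y orth]
  proof (elim disjE exE conjE)
    assume "x = 0"
    moreover have "is_lub G y {0, y}"
      using lub_bottom[OF y] by (simp add: insert_commute)
    ultimately show ?thesis
      using G.join_eqI by auto
  next
    assume "y = 0"
    then show ?thesis
      using G.join_eqI[OF lub_bottom[OF x]] by auto
  next
    assume "y = ocompl G x"
    then show ?thesis
      using G.join_eqI[OF lub_complement[OF x]] G_elem_cases[OF x] by auto
  next
    fix p q assume pq: "x = atom_code p" "y = atom_code q" "p \<frown> q"
    then have "w p + w q + w (third p q) = 1" "third p q \<in> P"
      using w third_adj[OF pq(3)] adj_point2 by (auto simp: weight_def)
    then show ?thesis
      using pq G.join_eqI[OF lub_adjacent[OF pq(3)]] x y by auto
  qed
  ultimately show ?thesis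
    by (simp add: states_def top_G PiE_def Pi_def)
qed

lemma state_of_two_valued:
  assumes "weight w" "\<forall>p\<in>P. w p \<in> {0, 1}"
  shows "state_of w \<in> two_valued_states G"
proof -
  have "state_of w x \<in> {0, 1}" if "x \<in> carrier G" for x
    using G_elem_cases[OF that] assms(2) by auto
  then show ?thesis
    using state_of_weight[OF assms(1)] by (simp add: two_valued_states_def)
qed

lemma states_G: "states G = state_of ` {w. weight w}"
proof
  show "states G \<subseteq> state_of ` {w. weight w}"
    using state_weight state_of_state by (metis (no_types, lifting) image_eqI mem_Collect_eq subsetI)
qed (use state_of_weight in auto)

end

section \<open>Criteria for fullness and regularity\<close>

context point_logic
begin

lemma state_of_cong: "(\<And>p. p \<in> P \<Longrightarrow> w p = w' p) \<Longrightarrow> state_of w = state_of w'"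
  by (rule extensionalityI[of _ "carrier G"])
     (auto simp: state_of_def carrier_G atom_code_def coatom_code_def)

lemma two_valued_weight_adjacent:
  assumes w: "weight w" "w p = 1" and pq: "p \<frown> q"
  shows "w q = 0"
proof -
  have "0 \<le> w q" "0 \<le> w (third p q)" "w p + w q + w (third p q) = 1"
    using w(1) pq third_adj[OF pq] adj_point2 by (auto simp: weight_def)
  then show ?thesis
    using w(2) by linarith
qed

text \<open>Were \<open>p\<close> adjacent to both other vertices of a triangle through
  \<open>q\<close>, the edge between them would be completed by \<open>p\<close> and by
  \<open>q\<close>.\<close>

lemma not_adj_both_ends:
  assumes "\<not> p \<frown> q" "p \<noteq> q" "q \<in> P"
  shows "\<exists>r. q \<frown> r \<and> \<not> p \<frown> r"
proof -
  obtain r where r: "q \<frown> r"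
    using ex_nbr assms(3) by blast
  have "\<not> (p \<frown> r \<and> p \<frown> third q r)"
    using third_unique[of r "third q r" p] third_unique[of r "third q r" q] third_adj[OF r] r
      adj_sym assms(2) by metis
  then show ?thesis
    using r third_adj[OF r] by blast
qed

text \<open>The hypothesis separates an atom from a coatom not above it; it includes
  \<open>p = q\<close>, as adjacency is irreflexive. The other pairs reduce to it, because a value 1
  forces 0 on all neighbours.\<close>

lemma full_two_valued_states:
  assumes both: "\<And>p q. \<lbrakk>p \<in> P; q \<in> P; \<not> p \<frown> q\<rbrakk> \<Longrightarrow>
    \<exists>w. weight w \<and> (\<forall>r\<in>P. w r \<in> {0, 1}) \<and> w p = 1 \<and> w q = 1"
  shows "full_states G (two_valued_states G)"
proof -
  let ?W = "\<lambda>w. weight w \<and> (\<forall>r\<in>P. w r \<in> {0, 1})"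
  have one: "\<exists>w. ?W w \<and> w p = 1" if "p \<in> P" for p
    using both[OF that that] adj_irrefl by blast
  \<comment> \<open>For non-adjacent points, the value 1 is placed on \<open>p\<close> and on a
    neighbour of \<open>q\<close> that is not adjacent to \<open>p\<close>.\<close>
  have one_zero: "\<exists>w. ?W w \<and> w p = 1 \<and> w q = 0" if pq: "p \<in> P" "q \<in> P" "p \<noteq> q" for p q
  proof (cases "p \<frown> q")
    case True
    then show ?thesis
      using one[OF pq(1)] two_valued_weight_adjacent by blast
  next
    case False
    obtain r where r: "q \<frown> r" "\<not> p \<frown> r"
      using not_adj_both_ends[OF False pq(3,2)] by blast
    then show ?thesis
      using both[OF pq(1) adj_point2[OF r(1)] r(2)] two_valued_weight_adjacent adj_sym by blast
  qed
  \<comment> \<open>The value 1 is placed on the third vertex of the edge, on a common neighbour, or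
    on non-adjacent neighbours \<open>r\<close> of \<open>p\<close> and \<open>t\<close> of
    \<open>q\<close>.\<close>
  have zero_zero: "\<exists>w. ?W w \<and> w p = 0 \<and> w q = 0" if pq: "p \<in> P" "q \<in> P" for p q
  proof (cases "p \<frown> q")
    case True
    then show ?thesis
      using third_adj[OF True] one[of "third p q"] two_valued_weight_adjacent adj_sym adj_point2
      by meson
  next
    case False
    obtain r where r: "p \<frown> r"
      using ex_nbr pq by blast
    show ?thesis
    proof (cases "r \<frown> q")
      case True
      then show ?thesis
        using one[OF adj_point2[OF r]] two_valued_weight_adjacent[OF _ _ True]
          two_valued_weight_adjacent[OF _ _ adj_sym[OF r]] by blast
    next
      case nadj: False
      have "r \<noteq> q"
        using r False by blast
      then obtain t where t: "q \<frown> t" "\<not> r \<frown> t"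
        using not_adj_both_ends[OF nadj _ pq(2)] by blast
      then show ?thesis
        using both[OF adj_point2[OF r] adj_point2[OF t(1)] t(2)]
          two_valued_weight_adjacent[OF _ _ adj_sym[OF r]]
          two_valued_weight_adjacent[OF _ _ adj_sym[OF t(1)]] by blast
    qed
  qed
  have two_valued: "state_of w \<in> two_valued_states G" if "?W w" for w
    using that state_of_two_valued by blast
  have separate: "\<exists>s\<in>two_valued_states G. \<not> s x \<le> s y"
    if xy: "x \<in> carrier G" "y \<in> carrier G" "\<not> x \<sqsubseteq>\<^bsub>G\<^esub> y" for x y
  proof -
    have "\<exists>w. ?W w \<and> state_of w x = 1 \<and> state_of w y = 0"
      using G_elem_cases[OF xy(1)] G_elem_cases[OF xy(2)]
    proof (elim disjE bexE)
      fix p q assume "p \<in> P" "q \<in> P" "x = coatom_code p" "y = coatom_code q"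
      then show ?thesis
        using one_zero[of q p] xy(3) by auto
    next
      fix p q assume pq: "p \<in> P" "q \<in> P" "x = atom_code p" "y = coatom_code q"
      then show ?thesis
        using both[of p q] xy(3) by auto
    next
      fix p q assume "p \<in> P" "q \<in> P" "x = coatom_code p" "y = atom_code q"
      then show ?thesis
        using zero_zero[of p q] by auto
    next
      fix p q assume "p \<in> P" "q \<in> P" "x = atom_code p" "y = atom_code q"
      then show ?thesis
        using one_zero[of p q] xy(3) by auto
    next
      fix p assume "p \<in> P" "x = atom_code p" "y = 0"
      then show ?thesis
        using one[of p] by auto
    next
      fix p assume "p \<in> P" "x = coatom_code p" "y = 0"
      then show ?thesis
        using zero_zero[of p p] by auto
    next
      fix p assume "p \<in> P" "x = Suc 0" "y = atom_code p"
      then show ?thesis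
        using zero_zero[of p p] by auto
    next
      fix p assume "p \<in> P" "x = Suc 0" "y = coatom_code p"
      then show ?thesis
        using one[of p] by auto
    next
      assume "x = Suc 0" "y = 0"
      then show ?thesis
        using points_nonempty one by auto
    qed (use xy(3) in auto)
    then obtain w where "?W w" "state_of w x = 1" "state_of w y = 0"
      by blast
    then show ?thesis
      using two_valued by (intro bexI[of _ "state_of w"]) auto
  qed
  have "s x \<le> s y"
    if s: "s \<in> two_valued_states G" and xy: "x \<in> carrier G" "y \<in> carrier G" "x \<sqsubseteq>\<^bsub>G\<^esub> y"
    for s x y
  proof -
    obtain w where w: "weight w" "s = state_of w"
      using s by (auto simp: two_valued_states_def states_G)
    have "w p \<le> 1 - w q" if "p \<frown> q" for p q
      using w(1) that third_adj[OF that] adj_point2[of q "third p q"]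
      by (force simp: weight_def)
    then show ?thesis
      using G_elem_cases[OF xy(1)] G_elem_cases[OF xy(2)] xy(3) w weight_le_1[OF w(1)]
      by (auto simp: weight_def)
  qed
  then show ?thesis
    unfolding full_states_def using separate by blast
qed

text \<open>On atoms, a signed measure is a function with constant sum on triangles, hence a
  combination of the weights \<open>W i\<close>. The same coefficients, used as point masses at the
  corresponding two-valued states, give the extension.\<close>

lemma regular_if_spanned:
  fixes W :: "'i \<Rightarrow> nat \<Rightarrow> real"
  assumes full: "full_states G (two_valued_states G)"
    and W: "\<And>i. i \<in> I \<Longrightarrow> weight (W i) \<and> (\<forall>p\<in>P. W i p \<in> {0, 1})"
    and span: "\<And>f c. (\<forall>p q. p \<frown> q \<longrightarrow> f p + f q + f (third p q) = c) \<Longrightarrow>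
      \<exists>k. \<forall>p\<in>P. f p = (\<Sum>i\<in>I. k i * W i p)"
  shows "regular_concrete_logic (two_valued_states G) (total_representation G)"
  unfolding regular_concrete_logic_def
proof (intro conjI allI impI)
  let ?S = "two_valued_states G"
  show "concrete_logic ?S (total_representation G)"
    by (rule G.total_representation_concrete[OF full])
  fix \<mu> assume \<mu>: "signed_measure (total_representation G) \<mu>"
  define T where "T x = {s \<in> ?S. s x = 1}" for x
  have E: "total_representation G = T ` carrier G"
    by (simp add: total_representation_def T_def)
  \<comment> \<open>Stated for arbitrary \<open>m\<close>, since it serves both the given measure
    and its extension.\<close>
  have split: "m (T (atom_code p)) + m (T (atom_code q)) + m (T (atom_code (third p q))) = m ?S"
    if m: "signed_measure (T ` carrier G) m" and pq: "p \<frown> q" for m p q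
  proof -
    let ?r = "third p q"
    have mem: "p \<in> P" "q \<in> P" "?r \<in> P"
      using pq third_adj[OF pq] adj_point adj_point2 by auto
    have sum: "s (atom_code p) + s (atom_code q) + s (atom_code ?r) = 1"
      and co: "s (coatom_code ?r) = 1 - s (atom_code ?r)"
      and vals: "s (atom_code p) \<in> {0, 1}" "s (atom_code q) \<in> {0, 1}" "s (atom_code ?r) \<in> {0, 1}"
      and top: "s (Suc 0) = 1"
      if "s \<in> ?S" for s
      using that state_sum[OF _ pq, of s] G.state_ocompl[of s "atom_code ?r"] mem
      by (auto simp: two_valued_states_def states_def top_G)
    have "T (atom_code p) \<inter> T (atom_code q) = {}"
      "T (atom_code p) \<union> T (atom_code q) = T (coatom_code ?r)"
      "T (coatom_code ?r) \<inter> T (atom_code ?r) = {}" "T (coatom_code ?r) \<union> T (atom_code ?r) = ?S"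
      using sum co vals unfolding T_def by fastforce+
    then show ?thesis
      using m mem unfolding signed_measure_def by (metis imageI in_carrier_G(3,4))
  qed
  have empty: "m {} = 0" if "signed_measure F m" "{} \<in> F" for F and m :: "'b set \<Rightarrow> real"
    using that unfolding signed_measure_def by (metis Un_empty add_cancel_right_left inf_bot_left)
  obtain k where k: "\<forall>p\<in>P. \<mu> (T (atom_code p)) = (\<Sum>i\<in>I. k i * W i p)"
    using span[of "\<lambda>p. \<mu> (T (atom_code p))" "\<mu> ?S"] split \<mu> unfolding E by blast
  define \<nu> where "\<nu> X = (\<Sum>i\<in>I. k i * of_bool (state_of (W i) \<in> X))" for X
  have \<nu>: "signed_measure (Pow ?S) \<nu>"
  proof -
    have "\<nu> (X \<union> Y) = \<nu> X + \<nu> Y" if "X \<inter> Y = {}" for X Y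
      using that unfolding \<nu>_def sum.distrib[symmetric]
      by (intro sum.cong) (auto simp: of_bool_def)
    then show ?thesis
      by (simp add: signed_measure_def)
  qed
  have \<nu>T: "signed_measure (T ` carrier G) \<nu>"
    using \<nu> unfolding signed_measure_def T_def by auto
  have atom: "\<nu> (T (atom_code p)) = \<mu> (T (atom_code p))" if p: "p \<in> P" for p
  proof -
    have "W i p = of_bool (state_of (W i) \<in> T (atom_code p))" if "i \<in> I" for i
      using W[OF that] state_of_two_valued[of "W i"] p by (auto simp: T_def)
    then have "\<nu> (T (atom_code p)) = (\<Sum>i\<in>I. k i * W i p)"
      unfolding \<nu>_def by (intro sum.cong) auto
    then show ?thesis
      using k p by simp
  qed
  \<comment> \<open>The total mass is the sum over any one triangle, so agreement on atoms carries
    over to it and then to coatoms.\<close>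
  have whole: "\<nu> ?S = \<mu> ?S"
  proof -
    obtain p q where pq: "p \<frown> q"
      using points_nonempty ex_nbr by blast
    then have "p \<in> P" "q \<in> P" "third p q \<in> P"
      using third_adj[OF pq] adj_point adj_point2 by auto
    then show ?thesis
      using split[OF \<nu>T pq] split[OF \<mu>[unfolded E] pq] atom by simp
  qed
  have "\<nu> (T x) = \<mu> (T x)" if x: "x \<in> carrier G" for x
    using G_elem_cases[OF x]
  proof (elim disjE bexE)
    assume "x = 0"
    have "s x \<noteq> 1" if "s \<in> ?S" for s
      using that G.state_ocompl[of s "Suc 0"] \<open>x = 0\<close>
      by (auto simp: two_valued_states_def states_def top_G)
    then have "T x = {}"
      by (simp add: T_def)
    then have "{} \<in> T ` carrier G"
      using x by (metis imageI)
    then show ?thesis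
      using \<open>T x = {}\<close> empty[OF \<nu>T] empty[OF \<mu>[unfolded E]] by simp
  next
    assume "x = Suc 0"
    then have "T x = ?S"
      by (auto simp: T_def two_valued_states_def states_def top_G)
    then show ?thesis
      using whole by simp
  next
    fix p assume "p \<in> P" "x = atom_code p"
    then show ?thesis
      using atom by simp
  next
    fix p assume p: "p \<in> P" "x = coatom_code p"
    have "s (coatom_code p) = 1 - s (atom_code p)" "s (atom_code p) \<in> {0, 1}" if "s \<in> ?S" for s
      using that G.state_ocompl[of s "atom_code p"] p(1) by (auto simp: two_valued_states_def)
    then have "T x \<inter> T (atom_code p) = {}" "T x \<union> T (atom_code p) = ?S"
      unfolding T_def p(2) by fastforce+
    then have diff: "m (T x) = m ?S - m (T (atom_code p))" if "signed_measure (T ` carrier G) m"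
      for m :: "(nat \<Rightarrow> real) set \<Rightarrow> real"
      using that x p(1) unfolding signed_measure_def
      by (metis add_diff_cancel_right' imageI in_carrier_G(3))
    then show ?thesis
      using diff[OF \<nu>T] diff[OF \<mu>[unfolded E]] whole atom[OF p(1)] by simp
  qed
  then show "\<exists>\<nu>. signed_measure (Pow ?S) \<nu> \<and> (\<forall>x\<in>total_representation G. \<nu> x = \<mu> x)"
    using \<nu> unfolding E by auto
qed

end

section \<open>Graphs given by a list of lines\<close>

definition line_nbrs :: "nat list list \<Rightarrow> nat \<Rightarrow> nat list" where
  "line_nbrs Ls p = concat (map (removeAll p) (filter (\<lambda>T. p \<in> set T) Ls))"

lemma set_line_nbrs: "set (line_nbrs Ls p) = {q. q \<noteq> p \<and> (\<exists>T\<in>set Ls. p \<in> set T \<and> q \<in> set T)}"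
  by (auto simp: line_nbrs_def)

definition nbr_table :: "nat \<Rightarrow> nat list list \<Rightarrow> nat list list" where
  "nbr_table n Ls = map (line_nbrs Ls) [0..<n]"

text \<open>An executable test. When the rows come from lines of three points, six distinct entries
  mean three lines through each point with no second point in common; the filter says that each edge
  lies in one triangle only.\<close>

definition thick_table :: "nat list list \<Rightarrow> bool" where
  "thick_table tab \<longleftrightarrow> (\<forall>N\<in>set tab. distinct N \<and> length N = 6 \<and>
     (\<forall>q\<in>set N. length (filter (\<lambda>r. r \<in> set (tab ! q)) N) = 1))"

locale line_list =
  fixes n :: nat and Ls :: "nat list list"
  assumes n_pos: "0 < n"
    and lines: "\<forall>T\<in>set Ls. length T = 3 \<and> distinct T \<and> (\<forall>p\<in>set T. p < n)"
    and table: "thick_table (nbr_table n Ls)"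
begin

definition coll :: "nat \<Rightarrow> nat \<Rightarrow> bool" where
  "coll p q \<longleftrightarrow> q \<in> set (line_nbrs Ls p)"

lemma coll_iff: "coll p q \<longleftrightarrow> q \<noteq> p \<and> (\<exists>T\<in>set Ls. p \<in> set T \<and> q \<in> set T)"
  by (simp add: coll_def set_line_nbrs)

lemma coll_less: "coll p q \<Longrightarrow> p < n"
  using lines by (auto simp: coll_iff)

lemma coll_sym: "coll p q \<Longrightarrow> coll q p"
  by (auto simp: coll_iff)

lemma line_nbrs_props:
  assumes "p < n"
  shows "distinct (line_nbrs Ls p)" "length (line_nbrs Ls p) = 6"
    "q \<in> set (line_nbrs Ls p) \<Longrightarrow>
      length (filter (\<lambda>r. r \<in> set (line_nbrs Ls q)) (line_nbrs Ls p)) = 1"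
proof -
  have "line_nbrs Ls p \<in> set (nbr_table n Ls)"
    using assms by (auto simp: nbr_table_def)
  note * = table[unfolded thick_table_def, THEN bspec, OF this]
  show "distinct (line_nbrs Ls p)" "length (line_nbrs Ls p) = 6"
    using * by auto
  assume q: "q \<in> set (line_nbrs Ls p)"
  then have "q < n"
    using coll_less[OF coll_sym] unfolding coll_def by blast
  then have "nbr_table n Ls ! q = line_nbrs Ls q"
    by (simp add: nbr_table_def)
  then show "length (filter (\<lambda>r. r \<in> set (line_nbrs Ls q)) (line_nbrs Ls p)) = 1"
    using * q by auto
qed

sublocale point_logic "{..<n}" coll
proof
  fix p q
  show "p \<in> {..<n}" if "coll p q"
    using that coll_less by simp
  show "coll q p" if "coll p q"
    using that by (rule coll_sym)
  show "\<not> coll p p"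
    by (simp add: coll_iff)
  show "\<exists>!r. coll p r \<and> coll q r" if "coll p q"
  proof -
    have "length (filter (\<lambda>r. r \<in> set (line_nbrs Ls q)) (line_nbrs Ls p)) = 1"
      using line_nbrs_props(3) coll_less that unfolding coll_def by blast
    then obtain r where "filter (\<lambda>r. r \<in> set (line_nbrs Ls q)) (line_nbrs Ls p) = [r]"
      by (auto simp: length_Suc_conv)
    then have "set (filter (\<lambda>r. r \<in> set (line_nbrs Ls q)) (line_nbrs Ls p)) = {r}"
      by simp
    then have "{r. coll p r \<and> coll q r} = {r}"
      by (simp add: coll_def)
    then show ?thesis
      by (intro ex1I[of _ r]) blast+
  qed
  show "\<exists>q. coll p q" if "p \<in> {..<n}"
    using line_nbrs_props(2)[of p] that unfolding coll_def
    by (metis lessThan_iff list.set_sel(1) list.size(3) zero_neq_numeral)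
qed (use n_pos in auto)

lemma card_coll: "\<forall>p\<in>{..<n}. card {q. coll p q} = 6"
  using line_nbrs_props by (auto simp: coll_def distinct_card)

lemma line_shape:
  assumes "T \<in> set Ls"
  shows "\<exists>a b c. T = [a, b, c] \<and> a \<noteq> b \<and> b \<noteq> c \<and> a \<noteq> c \<and>
    coll a b \<and> coll a c \<and> coll b a \<and> coll b c \<and> coll c a \<and> coll c b"
proof -
  have T: "length T = 3" "distinct T"
    using lines assms by auto
  then obtain a b c where abc: "T = [a, b, c]"
    by (auto simp: length_Suc_conv numeral_3_eq_3)
  have "coll x y" if "x \<in> set T" "y \<in> set T" "x \<noteq> y" for x y
    using assms that unfolding coll_iff by blast
  then show ?thesis
    using T(2) abc by auto
qed

lemma third_in_line:
  assumes "T \<in> set Ls"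
  shows "\<exists>p q. T = [p, q, third p q] \<and> coll p q"
  using line_shape[OF assms] third_unique by metis

lemma third_line_sum:
  fixes f :: "nat \<Rightarrow> real"
  assumes "coll p q"
  shows "\<exists>T\<in>set Ls. f p + f q + f (third p q) = sum_list (map f T)"
proof -
  obtain T where T: "T \<in> set Ls" "p \<in> set T" "q \<in> set T" "p \<noteq> q"
    using assms by (auto simp: coll_iff)
  obtain a b c where abc: "T = [a, b, c]"
    and coll: "coll a b" "coll a c" "coll b a" "coll b c" "coll c a" "coll c b"
    using line_shape[OF T(1)] by blast
  have "third a b = c" "third b a = c" "third a c = b" "third c a = b" "third b c = a" "third c b = a"
    using coll by (auto intro: third_unique)
  then have "f p + f q + f (third p q) = f a + f b + f c"
    using T(2-4) unfolding abc by auto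
  then show ?thesis
    using T(1) abc by (intro bexI[of _ T]) auto
qed

text \<open>Replaces conditions on adjacent pairs by one equation per listed line, for weights with
  \<open>c = 1\<close> and for the spanning argument with arbitrary \<open>c\<close>.\<close>

lemma line_sums_iff:
  fixes f :: "nat \<Rightarrow> real"
  shows "(\<forall>p q. coll p q \<longrightarrow> f p + f q + f (third p q) = c) \<longleftrightarrow>
    (\<forall>T\<in>set Ls. sum_list (map f T) = c)"
proof
  assume *: "\<forall>p q. coll p q \<longrightarrow> f p + f q + f (third p q) = c"
  show "\<forall>T\<in>set Ls. sum_list (map f T) = c"
  proof
    fix T assume "T \<in> set Ls"
    then obtain p q where T: "T = [p, q, third p q]" and pq: "coll p q"
      using third_in_line by blast
    have "sum_list (map f T) = f p + f q + f (third p q)"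
      by (subst T) simp
    then show "sum_list (map f T) = c"
      using * pq by simp
  qed
next
  assume "\<forall>T\<in>set Ls. sum_list (map f T) = c"
  then show "\<forall>p q. coll p q \<longrightarrow> f p + f q + f (third p q) = c"
    using third_line_sum by metis
qed

lemma weight_iff: "weight w \<longleftrightarrow> (\<forall>p<n. 0 \<le> w p) \<and> (\<forall>T\<in>set Ls. sum_list (map w T) = 1)"
  by (auto simp: weight_def line_sums_iff)

end

section \<open>The 17-atom logic\<close>

text \<open>A configuration of 17 points and 17 lines, three points on a line and three lines
  through a point, in which all triangles of the collinearity graph are lines.\<close>

definition lines17 :: "nat list list" where
  "lines17 = [[0,1,2], [0,3,4], [0,5,6], [1,7,8], [1,9,10], [2,11,12], [2,13,14], [3,7,11], [3,9,13],
    [4,8,14], [4,10,15], [5,8,12], [5,13,15], [6,10,11], [6,14,16], [7,15,16], [9,12,16]]"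

interpretation L17: line_list 17 lines17
proof
  show "thick_table (nbr_table 17 lines17)"
    by (simp add: nbr_table_def lines17_def line_nbrs_def upt_rec) (simp add: thick_table_def)
qed (simp_all add: lines17_def)

lemma upt17: "[0..<17] = [0,1,2,3,4,5,6,7,8,9,10,11,12,13,14,15,16]"
  by (simp add: upt_rec)

text \<open>The constant 1/3 shifted by \<open>x - 1/3\<close> times the kernel vector that is 1 on
  2, 4, 5, 16, is -1 on 0, 12, 14, 15, and vanishes elsewhere. The parameter is the value at point
  2.\<close>

definition weight17 :: "real \<Rightarrow> nat \<Rightarrow> real" where
  "weight17 x p = (if p \<in> {2, 4, 5, 16} then x else if p \<in> {0, 12, 14, 15} then 2/3 - x else 1/3)"

lemma weight17_iff:
  "L17.weight w \<longleftrightarrow> w 2 \<in> {0..2/3} \<and> (\<forall>p<17. w p = weight17 (w 2) p)"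
proof
  assume "L17.weight w"
  then have nonneg: "\<forall>p<17. 0 \<le> w p" and sums: "\<forall>T\<in>set lines17. sum_list (map w T) = 1"
    by (auto simp: L17.weight_iff)
  have eqs: "w 0 + w 1 + w 2 = 1" "w 0 + w 3 + w 4 = 1" "w 0 + w 5 + w 6 = 1" "w 1 + w 7 + w 8 = 1"
    "w 1 + w 9 + w 10 = 1" "w 2 + w 11 + w 12 = 1" "w 2 + w 13 + w 14 = 1" "w 3 + w 7 + w 11 = 1"
    "w 3 + w 9 + w 13 = 1" "w 4 + w 8 + w 14 = 1" "w 4 + w 10 + w 15 = 1" "w 5 + w 8 + w 12 = 1"
    "w 5 + w 13 + w 15 = 1" "w 6 + w 10 + w 11 = 1" "w 6 + w 14 + w 16 = 1" "w 7 + w 15 + w 16 = 1"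
    "w 9 + w 12 + w 16 = 1"
    using sums by (simp_all add: lines17_def add.assoc)
  \<comment> \<open>Alternating sums cancel the shared points: equations 6 - 8 + 9 - 13 + 16 - 17
    leave \<open>w 2 - w 5\<close>, and 11 - 5 + 4 - 12 - 16 + 17 leave \<open>w 4 - w 5\<close>.
    From \<open>w 0\<close> onwards each value is read off a single line.\<close>
  have w5: "w 5 = w 2"
    using eqs(6,8,9,13,16,17) by linarith
  have w4: "w 4 = w 2"
    using eqs(4,5,11,12,16,17) w5 by linarith
  have w16: "w 16 = w 2"
    using eqs(2,3,8,11,14,16) w4 w5 by linarith
  have w3: "w 3 = 1/3"
    using eqs(7,8,9,10,11,12,14,15,16,17) w4 w5 w16 by linarith
  have w1: "w 1 = 1/3"
    using eqs(5,9,11,13) w3 w4 w5 by linarith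
  have w6: "w 6 = 1/3"
    using eqs(8,11,14,16) w3 w4 w16 by linarith
  have w0: "w 0 = 2/3 - w 2"
    using eqs(3) w5 w6 by linarith
  have w14: "w 14 = 2/3 - w 2"
    using eqs(15) w6 w16 by linarith
  have w8: "w 8 = 1/3"
    using eqs(10) w4 w14 by linarith
  have w12: "w 12 = 2/3 - w 2"
    using eqs(12) w5 w8 by linarith
  have w9: "w 9 = 1/3"
    using eqs(17) w12 w16 by linarith
  have w13: "w 13 = 1/3"
    using eqs(9) w3 w9 by linarith
  have w15: "w 15 = 2/3 - w 2"
    using eqs(13) w5 w13 by linarith
  have w7: "w 7 = 1/3"
    using eqs(16) w15 w16 by linarith
  have w10: "w 10 = 1/3"
    using eqs(11) w4 w15 by linarith
  have w11: "w 11 = 1/3"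
    using eqs(14) w6 w10 by linarith
  have "\<forall>p\<in>set [0..<17]. w p = weight17 (w 2) p"
    by (simp add: upt17 weight17_def w0 w1[unfolded One_nat_def] w3 w4 w5 w6 w7 w8 w9 w10 w11 w12 w13 w14 w15 w16)
  have "w p = weight17 (w 2) p" if "p < 17" for p
  proof -
    have "p \<in> set [0..<17]"
      using that by simp
    then show ?thesis
      using \<open>\<forall>p\<in>set [0..<17]. w p = weight17 (w 2) p\<close> by blast
  qed
  moreover have "w 2 \<in> {0..2/3}"
    using nonneg[THEN spec, of 0] nonneg[THEN spec, of 2] w0 by simp
  ultimately show "w 2 \<in> {0..2/3} \<and> (\<forall>p<17. w p = weight17 (w 2) p)"
    by blast
next
  assume *: "w 2 \<in> {0..2/3} \<and> (\<forall>p<17. w p = weight17 (w 2) p)"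
  then have eq: "w p = weight17 (w 2) p" if "p < 17" for p
    using that by blast
  have "\<forall>T\<in>set lines17. sum_list (map w T) = sum_list (map (weight17 (w 2)) T)"
    using L17.lines eq by (metis (mono_tags, lifting) map_eq_conv)
  moreover have "\<forall>T\<in>set lines17. sum_list (map (weight17 x) T) = 1" for x
    by (simp add: weight17_def lines17_def)
  moreover have "0 \<le> weight17 x p" if "x \<in> {0..2/3}" for x p
    using that by (auto simp: weight17_def)
  then have "0 \<le> w p" if "p < 17" for p
    using eq[OF that] * by metis
  ultimately show "L17.weight w"
    by (simp add: L17.weight_iff)
qed

lemma L17_states: "states L17.G = (\<lambda>x. L17.state_of (weight17 x)) ` {0..2/3}"
proof
  show "states L17.G \<subseteq> (\<lambda>x. L17.state_of (weight17 x)) ` {0..2/3}"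
  proof
    fix s assume "s \<in> states L17.G"
    then obtain w where w: "L17.weight w" "s = L17.state_of w"
      by (auto simp: L17.states_G)
    then have "s = L17.state_of (weight17 (w 2))"
      using weight17_iff L17.state_of_cong[of w "weight17 (w 2)"] by blast
    then show "s \<in> (\<lambda>x. L17.state_of (weight17 x)) ` {0..2/3}"
      using w(1) weight17_iff by blast
  qed
  show "(\<lambda>x. L17.state_of (weight17 x)) ` {0..2/3} \<subseteq> states L17.G"
  proof
    fix s assume "s \<in> (\<lambda>x. L17.state_of (weight17 x)) ` {0..2/3}"
    then obtain x where x: "x \<in> {0..2/3}" "s = L17.state_of (weight17 x)"
      by blast
    have "weight17 x 2 = x"
      by (simp add: weight17_def)
    then have "L17.weight (weight17 x)"
      using x(1) by (simp add: weight17_iff)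
    then show "s \<in> states L17.G"
      using x(2) L17.state_of_weight by simp
  qed
qed

lemma L17_affine: "affinely_isomorphic_states L17.G {0..2/3 :: real}"
proof -
  \<comment> \<open>Evaluation at the atom of point 2 returns the parameter.\<close>
  let ?\<phi> = "\<lambda>s. s (atom_code 2) :: real"
  have inv: "?\<phi> (L17.state_of (weight17 x)) = x" for x
    by (simp add: weight17_def)
  have "bij_betw ?\<phi> (states L17.G) {0..2/3}"
    by (rule bij_betw_byWitness[where f' = "\<lambda>x. L17.state_of (weight17 x)"])
       (auto simp: L17_states inv)
  moreover have "?\<phi> (mix L17.G u s t) = (1 - u) *\<^sub>R ?\<phi> s + u *\<^sub>R ?\<phi> t" for u s t
    by (simp add: mix_def)
  ultimately show ?thesis
    unfolding affinely_isomorphic_states_def by blast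
qed

text \<open>Every state has the value 1/3 at point 1.\<close>

lemma L17_no_two_valued: "two_valued_states L17.G = {}"
proof -
  have "s (atom_code 1) \<notin> {0, 1}" if "s \<in> states L17.G" for s
    using that by (auto simp: L17_states weight17_def)
  moreover have "atom_code 1 \<in> carrier L17.G"
    by simp
  ultimately show ?thesis
    unfolding two_valued_states_def by blast
qed

section \<open>The 27-atom logic\<close>

text \<open>The point with coordinates \<open>i\<close>, \<open>j\<close>, \<open>k\<close> is coded
  in base 3; the three lists are the lines parallel to each axis.\<close>

definition lines27 :: "nat list list" where
  "lines27 = [[9 * i + 3 * j + k. k \<leftarrow> [0, 1, 2]]. i \<leftarrow> [0, 1, 2], j \<leftarrow> [0, 1, 2]] @
    [[9 * i + 3 * j + k. j \<leftarrow> [0, 1, 2]]. i \<leftarrow> [0, 1, 2], k \<leftarrow> [0, 1, 2]] @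
    [[9 * i + 3 * j + k. i \<leftarrow> [0, 1, 2]]. j \<leftarrow> [0, 1, 2], k \<leftarrow> [0, 1, 2]]"

text \<open>Affine planes over Z/3 whose normal vector has no zero entry, scaled so that its last
  entry is 1. The divisions extract the base 3 digits.\<close>

definition planes27 :: "nat list list" where
  "planes27 = [[p \<leftarrow> [0..<27]. (a * (p div 9) + b * (p div 3 mod 3) + p mod 3) mod 3 = c].
    a \<leftarrow> [1, 2], b \<leftarrow> [1, 2], c \<leftarrow> [0, 1, 2]]"

lemma upt27: "[0..<27] =
  [0,1,2,3,4,5,6,7,8,9,10,11,12,13,14,15,16,17,18,19,20,21,22,23,24,25,26]"
  by (simp add: upt_rec)

lemma lines27_eq: "lines27 =
   [[0, 1, 2], [3, 4, 5], [6, 7, 8], [9, 10, 11], [12, 13, 14], [15, 16, 17], [18, 19, 20],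
    [21, 22, 23], [24, 25, 26], [0, 3, 6], [1, 4, 7], [2, 5, 8], [9, 12, 15], [10, 13, 16],
    [11, 14, 17], [18, 21, 24], [19, 22, 25], [20, 23, 26], [0, 9, 18], [1, 10, 19], [2, 11, 20],
    [3, 12, 21], [4, 13, 22], [5, 14, 23], [6, 15, 24], [7, 16, 25], [8, 17, 26]]"
  by (simp add: lines27_def)

lemma planes27_eq: "planes27 =
   [[0, 5, 7, 11, 13, 15, 19, 21, 26], [1, 3, 8, 9, 14, 16, 20, 22, 24],
    [2, 4, 6, 10, 12, 17, 18, 23, 25], [0, 4, 8, 11, 12, 16, 19, 23, 24],
    [1, 5, 6, 9, 13, 17, 20, 21, 25], [2, 3, 7, 10, 14, 15, 18, 22, 26],
    [0, 5, 7, 10, 12, 17, 20, 22, 24], [1, 3, 8, 11, 13, 15, 18, 23, 25],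
    [2, 4, 6, 9, 14, 16, 19, 21, 26], [0, 4, 8, 10, 14, 15, 20, 21, 25],
    [1, 5, 6, 11, 12, 16, 18, 22, 26], [2, 3, 7, 9, 13, 17, 19, 23, 24]]"
  by (simp add: planes27_def upt27)

interpretation L27: line_list 27 lines27
proof
  show "thick_table (nbr_table 27 lines27)"
    by (simp add: nbr_table_def lines27_eq line_nbrs_def upt27) (simp add: thick_table_def)
qed (simp_all add: lines27_eq)

definition plane_weight :: "nat list \<Rightarrow> nat \<Rightarrow> real" where
  "plane_weight S p = of_bool (p \<in> set S)"

text \<open>As no entry of the normal vector vanishes, an axis-parallel line meets the plane in
  exactly one point.\<close>

lemma plane_weight: "S \<in> set planes27 \<Longrightarrow> L27.weight (plane_weight S)"
proof -
  have "\<forall>S\<in>set planes27. \<forall>T\<in>set lines27. sum_list (map (plane_weight S) T) = 1"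
    by (simp add: plane_weight_def lines27_eq planes27_eq)
  then show "S \<in> set planes27 \<Longrightarrow> L27.weight (plane_weight S)"
    unfolding L27.weight_iff plane_weight_def by auto
qed

definition common_plane_pts :: "nat \<Rightarrow> nat list" where
  "common_plane_pts p = concat (filter (\<lambda>S. p \<in> set S) planes27)"

lemma set_common_plane_pts:
  "set (common_plane_pts p) = {q. \<exists>S\<in>set planes27. p \<in> set S \<and> q \<in> set S}"
  by (auto simp: common_plane_pts_def)

text \<open>A difference with at least two nonzero coordinates is orthogonal to some admissible
  normal vector. The check is by table: for each \<open>p\<close>, its neighbours and the points of
  the planes through it cover all 27 points.\<close>

lemma common_plane:
  assumes "p < 27" "q < 27" "\<not> L27.coll p q"
  shows "\<exists>S\<in>set planes27. p \<in> set S \<and> q \<in> set S"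
proof -
  have "\<forall>(N, M)\<in>set (zip (nbr_table 27 lines27) (map common_plane_pts [0..<27])).
      set [0..<27] \<subseteq> set N \<union> set M"
    by (simp add: nbr_table_def lines27_eq line_nbrs_def common_plane_pts_def planes27_eq upt27)
  moreover have "(line_nbrs lines27 p, common_plane_pts p) \<in>
      set (zip (nbr_table 27 lines27) (map common_plane_pts [0..<27]))"
    using assms(1) by (auto simp: nbr_table_def in_set_zip intro!: exI[of _ p])
  ultimately have "set [0..<27] \<subseteq> set (line_nbrs lines27 p) \<union> set (common_plane_pts p)"
    by blast
  then show ?thesis
    using assms(2,3) by (auto simp: L27.coll_def set_common_plane_pts)
qed

lemma L27_full: "full_states L27.G (two_valued_states L27.G)"
proof (rule L27.full_two_valued_states)
  fix p q :: nat assume "p \<in> {..<27}" "q \<in> {..<27}" "\<not> L27.coll p q"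
  then obtain S where S: "S \<in> set planes27" "p \<in> set S" "q \<in> set S"
    using common_plane by auto
  show "\<exists>w. L27.weight w \<and> (\<forall>r\<in>{..<27}. w r \<in> {0, 1}) \<and> w p = 1 \<and> w q = 1"
    using plane_weight[OF S(1)] S(2,3)
    by (intro exI[of _ "plane_weight S"]) (auto simp: plane_weight_def)
qed

text \<open>
  Fourier inversion on the cube: of the four planes through \<open>p\<close>, none contains a given point
  differing from \<open>p\<close> in one coordinate, two contain a given point differing in two coordinates, and
  one contains a given point differing in three.
\<close>
lemma plane_inversion:
  fixes f :: "nat \<Rightarrow> real"
  assumes sums: "\<forall>T\<in>set lines27. sum_list (map f T) = c" and p: "p < 27"
  shows "f p = (\<Sum>S\<in>set planes27. (sum_list (map f S) / 9 - c / 4) * plane_weight S p)"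
proof -
  have line: "f r = c - f p - f q" if "[p, q, r] \<in> set lines27" for p q r
    using sums[THEN bspec, OF that] by simp
  \<comment> \<open>Constant line sums determine 19 of the values from \<open>c\<close> and the
    eight values at points with all coordinates in \<open>{0, 1}\<close>.\<close>
  have dep: "f 2 = c - f 0 - f 1" "f 5 = c - f 3 - f 4" "f 8 = c - f 6 - f 7"
      "f 11 = c - f 9 - f 10" "f 14 = c - f 12 - f 13" "f 17 = c - f 15 - f 16"
      "f 20 = c - f 18 - f 19" "f 23 = c - f 21 - f 22" "f 26 = c - f 24 - f 25"
      "f 6 = c - f 0 - f 3" "f 7 = c - f 1 - f 4" "f 15 = c - f 9 - f 12"
      "f 16 = c - f 10 - f 13" "f 24 = c - f 18 - f 21" "f 25 = c - f 19 - f 22"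
      "f 18 = c - f 0 - f 9" "f 19 = c - f 1 - f 10" "f 21 = c - f 3 - f 12"
      "f 22 = c - f 4 - f 13"
    by (rule line, simp add: lines27_eq)+
  \<comment> \<open>The sums of \<open>f\<close> over the four planes through \<open>p\<close> add
    up to \<open>9 * f p + 9 * c\<close>, whence the constants 1/9 and 1/4.\<close>
  define h where "h p = (\<Sum>S\<leftarrow>planes27. (sum_list (map f S) / 9 - c / 4) * plane_weight S p)" for p
  have "map f [0..<27] = map h [0..<27]"
    by (simp add: upt27 h_def planes27_eq plane_weight_def) (simp add: dep[unfolded One_nat_def] field_simps)
  moreover have "distinct planes27"
    by (simp add: planes27_eq)
  moreover have "p \<in> set [0..<27]"
    using p by simp
  ultimately show ?thesis
    unfolding h_def map_eq_conv by (metis (no_types, lifting) sum.distinct_set_conv_list)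
qed

lemma L27_regular:
  "regular_concrete_logic (two_valued_states L27.G) (total_representation L27.G)"
proof (rule L27.regular_if_spanned[OF L27_full])
  show "L27.weight (plane_weight S) \<and> (\<forall>p\<in>{..<27}. plane_weight S p \<in> {0, 1})"
    if "S \<in> set planes27" for S
    using plane_weight[OF that] by (simp add: plane_weight_def)
  show "\<exists>k. \<forall>p\<in>{..<27}. f p = (\<Sum>S\<in>set planes27. k S * plane_weight S p)"
    if "\<forall>p q. L27.coll p q \<longrightarrow> f p + f q + f (L27.third p q) = c" for f c
  proof -
    have "\<forall>T\<in>set lines27. sum_list (map f T) = c"
      using that by (simp only: L27.line_sums_iff)
    then show ?thesis
      using plane_inversion[of f c]
      by (intro exI[of _ "\<lambda>S. sum_list (map f S) / 9 - c / 4"]) simp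
  qed
qed

section \<open>Assembly of the classification and the two examples\<close>

theorem theorem2p1:
  shows "(\<forall>L :: 'a orthoposet.
            orthomodular_poset L \<and> finite (carrier L) \<and> homogeneous 3 3 L \<and> card (atoms L) = 15
              \<longrightarrow> omp_isomorphic L L32)
       \<and> (\<exists>(L17 :: nat orthoposet) (L27 :: nat orthoposet).
            (orthomodular_poset L17 \<and> finite (carrier L17) \<and> homogeneous 3 3 L17 \<and>
             card (atoms L17) = 17)
          \<and> (orthomodular_poset L27 \<and> finite (carrier L27) \<and> homogeneous 3 3 L27 \<and>
             card (atoms L27) = 27)
          \<and> (two_valued_states L17 = {} \<and> affinely_isomorphic_states L17 {0..2/3 :: real})
          \<and> (full_states L27 (two_valued_states L27) \<and>
             regular_concrete_logic (two_valued_states L27) (total_representation L27)))"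
proof (intro conjI allI impI)
  fix L :: "'a orthoposet"
  assume L: "orthomodular_poset L \<and> finite (carrier L) \<and> homogeneous 3 3 L \<and> card (atoms L) = 15"
  then interpret orthomodular_poset L
    by simp
  interpret three_block_omp L
    using L by unfold_locales (auto simp: homogeneous_def)
  show "omp_isomorphic L L32"
    using L isomorphic_L32 by simp
next
  have "orthomodular_poset L17.G" "orthomodular_poset L27.G"
    by (rule L17.G.orthomodular_poset_axioms L27.G.orthomodular_poset_axioms)+
  moreover have "finite (carrier L17.G)" "finite (carrier L27.G)"
    by (rule L17.finite_carrier_G L27.finite_carrier_G)+
  moreover have "homogeneous 3 3 L17.G" "homogeneous 3 3 L27.G"
    by (rule L17.G_homogeneous[OF L17.card_coll] L27.G_homogeneous[OF L27.card_coll])+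
  moreover have "card (atoms L17.G) = 17" "card (atoms L27.G) = 27"
    by (simp_all add: L17.card_atoms_G L27.card_atoms_G)
  ultimately show "\<exists>(L17 :: nat orthoposet) (L27 :: nat orthoposet).
      (orthomodular_poset L17 \<and> finite (carrier L17) \<and> homogeneous 3 3 L17 \<and>
       card (atoms L17) = 17)
    \<and> (orthomodular_poset L27 \<and> finite (carrier L27) \<and> homogeneous 3 3 L27 \<and>
       card (atoms L27) = 27)
    \<and> (two_valued_states L17 = {} \<and> affinely_isomorphic_states L17 {0..2/3 :: real})
    \<and> (full_states L27 (two_valued_states L27) \<and>
       regular_concrete_logic (two_valued_states L27) (total_representation L27))"
    using L17_no_two_valued L17_affine L27_full L27_regular
    by (rule_tac exI[of _ L17.G], rule_tac exI[of _ L27.G]) simp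
qed

end
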